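(* Let $*:\hat S\to\widehat{{}^*S}$ be an enlargement, let $N\in\hat S$ be a set of sets, and let $\mathcal C$ be an $\hat S$-small category with $M:=\mathrm{Mor}_{\mathcal C}\subseteq N$. (i) Let $F:\mathcal C^\circ\to(N\text{-}\mathrm{Ens})$ be a functor (i.e. $F$ is a presheaf on $\mathcal C$ with values in $(N\text{-}\mathrm{Ens})$). Then ${}^*F$ is a presheaf on ${}^*\mathcal C$ with values in $({}^*N\text{-}\mathrm{Ens})$. (ii) If in particular we look at the presheaf $h_X:=\mathrm{Mor}_{\mathcal C}(\_,X):\mathcal C^\circ\to(M\text{-}\mathrm{Ens})\subseteq(N\text{-}\mathrm{Ens})$ for an element $X\in\mathrm{Ob}(\mathcal C)$, then ${}^*h_X=\mathrm{Mor}_{{}^*\mathcal C}(\_,{}^*X)=:h_{{}^*X}$. (iii) Consider the statement $$\varphi[F,X]\equiv\Bigl[\bigl(F\in\mathrm{Ob}(\mathrm{Funct}^\circ(\mathcal C,(N\text{-}\mathrm{Ens})))\bigr)\wedge\bigl(X\in\mathrm{Ob}(\mathcal C)\bigr)\wedge\bigl(F\text{ is representable by }X\bigr)\Bigr]$$ (this makes sense because of $M\subseteq N$). Then $${}^*\varphi[F,X]=\Bigl[F\text{ is an internal presheaf on }{}^*\mathcal C\text{ with values in }({}^*N\text{-}\mathrm{Ens})\text{ which is internally representable by }X\Bigr].$$ (By "internally representable" we mean that there is an object $Y\in\mathrm{Ob}({}^*\mathcal C)$ and an internal isomorphism of functors between $F$ and $\mathrm{Mor}_{{}^*\mathcal C}(\_,Y)$;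 $F$ is internally representable by $X$ if this holds with $Y=X$.) (iv) If a presheaf $F$ on $\mathcal C$ with values in $(N\text{-}\mathrm{Ens})$ is representable by an object $X\in\mathrm{Ob}(\mathcal C)$, then ${}^*F$ is representable by ${}^*X$. (v) If all presheaves on $\mathcal C$ with values in $(N\text{-}\mathrm{Ens})$ are representable, then all internal presheaves on ${}^*\mathcal C$ with values in $({}^*N\text{-}\mathrm{Ens})$ are representable.
   Context: Superstructures: a base set $S$ is an infinite set whose elements are not sets; $S_0=S$, $S_n=S_{n-1}\cup\mathcal P(S_{n-1})$ (where $\mathcal P$ denotes the power set), and $\hat S=\bigcup_{n\ge 0}S_n$. Formulas in $\hat S$ are built from $=$, $\in$, constants in $\hat S$, variables, ordered pairs and function application by $\neg$, $\wedge$ and bounded quantifiers $\forall x\in t$; statements are formulas without free variables. For $\varphi$ a formula in $\hat S$, ${}^*\varphi$ is obtained by replacing each constant $\tau$ by ${}^*\tau$. Enlargement: a map $*:\hat S\to\hat W$ between superstructures with (1) ${}^*S=W$; (2) ${}^*s=s$ for $s\in S$; (3) (transfer) a statement $\varphi$ in $\hat S$ is true iff ${}^*\varphi$ is true; (4) (saturation) with $\mathcal I=\bigcup_{A\in\hat S\setminus S}{}^*A$, every nonempty family $\{U_i\}_{i\in I}$ of nonempty sets $U_i\in\mathcal I$, with $|I|\le|\hat S|$ and such that all finite subfamilies have nonempty intersection, has nonempty intersection. Elements of $\mathcal I$ are called internal. $\hat S$-small category: a category $\mathcal C=\langle M,s,t,c\rangle$ given by its set of morphisms $M=\mathrm{Mor}_{\mathcal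 C}\in\hat S\setminus S$, the maps $s,t:M\to M$ sending a morphism to the identity of its source resp. target, and the composition relation $c=\{\langle f,g,h\rangle: f\circ g=h\}\subseteq M\times M\times M$; objects are identified with their identity morphisms, and $\mathrm{Ob}(\mathcal C)=s(M)$. $\mathrm{Mor}_{\mathcal C}(X,Y)$ is the set of morphisms from $X$ to $Y$, and $\mathcal C^\circ$ is the opposite category. The enlargement of $\mathcal C$ is the category ${}^*\mathcal C=\langle{}^*M,{}^*s,{}^*t,{}^*c\rangle$. A functor is a map on sets of morphisms compatible with $s,t,c$; a functor $F$ between $\hat S$-small categories is an element of $\hat S$, so ${}^*F$ is defined and is a functor between the enlarged categories. $\mathrm{Funct}^\circ(\mathcal C,\mathcal D)$ is the ($\hat S$-small) category of contravariant functors $\mathcal C\to\mathcal D$. For a set of sets $N$, $(N\text{-}\mathrm{Ens})$ is the category of sets that are elements of $N$ (with all maps as morphisms); for $N\in\hat S$ it is $\hat S$-small, and ${}^*(N\text{-}\mathrm{Ens})$ is the subcategory of $({}^*N\text{-}\mathrm{Ens})$ with all objects and with only the internal maps as morphisms. Functors and morphisms of functors are called internal if they are internal elements of $\widehat{{}^*S}$; ${}^*\mathrm{Funct}^\circ(\mathcal C,(N\text{-}\mathrm{Ens}))$ consists of the internal contravariant functors from ${}^*\mathcal C$ to ${}^*(N\text{-}\mathrm{Ens})$ and the internal morphisms between them, and its objects are the internal presheaves on ${}^*\mathcal C$ with values in $({}^*N\text{-}\mathrm{Ens})$. A presheaf $F$ on a category $\mathcal D$ is representable by an object $X$ of $\mathcal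 D$ if $F$ is isomorphic to $\mathrm{Mor}_{\mathcal D}(\_,X)$.
   Formalization: Since Mor_C(Y,X) is a subset of M and need not be an element of M or N, h_X is taken as a presheaf with values in (P(M)-Ens), and isomorphisms between F and h_X are taken in ((N ∪ P(M))-Ens), likewise for *C with *N and P( *M). *)

theory Defs
  imports "HOL-Library.Equipollence"
begin

section \<open>Sets with urelements\<close>

text \<open>
  A superstructure over an infinite set has more elements than any type definable in plain HOL,
  so the ambient set theory is a type class: second-order Zermelo set theory with urelements.
  The class holds for the set \<open>hat W\<close> below, for every base set \<open>W\<close>, so working inside it loses
  no generality.
\<close>

class set_universe =
  fixes is_set :: "'a \<Rightarrow> bool"
    and elts :: "'a \<Rightarrow> 'a set"
  assumes elts_urelement: "\<not> is_set x \<Longrightarrow> elts x = {}"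
    and extensionality: "is_set x \<Longrightarrow> is_set y \<Longrightarrow> elts x = elts y \<Longrightarrow> x = y"
    and pairing: "\<exists>z. is_set z \<and> elts z = {x, y}"
    and separation: "A \<subseteq> elts x \<Longrightarrow> \<exists>z. is_set z \<and> elts z = A"
    and union: "\<exists>z. is_set z \<and> elts z = \<Union> (elts ` elts x)"
    and power: "\<exists>z. is_set z \<and> elts z = {y. is_set y \<and> elts y \<subseteq> elts x}"

text \<open>Meaningful only when some set has exactly the elements \<open>A\<close>.\<close>

definition mk_set :: "'v::set_universe set \<Rightarrow> 'v" where
  "mk_set A = (THE z. is_set z \<and> elts z = A)"

definition opair :: "'v::set_universe \<Rightarrow> 'v \<Rightarrow> 'v" ("\<langle>_,/ _\<rangle>") where
  "\<langle>a, b\<rangle> = mk_set {mk_set {a}, mk_set {a, b}}"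

abbreviation triple :: "'v::set_universe \<Rightarrow> 'v \<Rightarrow> 'v \<Rightarrow> 'v" ("\<langle>_,/ _,/ _\<rangle>") where
  "\<langle>a, b, c\<rangle> \<equiv> \<langle>\<langle>a, b\<rangle>, c\<rangle>"

text \<open>
  Functions are their graphs.  Application is total: its value is the empty set where there is
  no unique value.
\<close>

definition app :: "'v::set_universe \<Rightarrow> 'v \<Rightarrow> 'v" (infixl "\<cdot>" 90) where
  "f \<cdot> x = (if \<exists>!y. \<langle>x, y\<rangle> \<in> elts f then THE y. \<langle>x, y\<rangle> \<in> elts f else mk_set {})"

definition is_map :: "'v::set_universe \<Rightarrow> 'v \<Rightarrow> 'v \<Rightarrow> bool" where
  "is_map f A B \<longleftrightarrow>
     is_set f \<and> elts f \<subseteq> {\<langle>x, y\<rangle> | x y. x \<in> elts A \<and> y \<in> elts B} \<and>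
     (\<forall>x\<in>elts A. \<exists>!y. \<langle>x, y\<rangle> \<in> elts f)"

definition power_set :: "'v::set_universe \<Rightarrow> 'v" where
  "power_set A = mk_set {B. is_set B \<and> elts B \<subseteq> elts A}"

definition set_union :: "'v::set_universe \<Rightarrow> 'v \<Rightarrow> 'v" where
  "set_union A B = mk_set (elts A \<union> elts B)"

lemma mk_set_eqI:
  fixes z :: "'v::set_universe"
  assumes "is_set z" "elts z = A"
  shows "mk_set A = z"
  unfolding mk_set_def by (rule the_equality) (use assms extensionality in auto)

lemma mk_set_doubleton [simp]:
  fixes a b :: "'v::set_universe"
  shows "is_set (mk_set {a, b})" "elts (mk_set {a, b}) = {a, b}"
  using pairing[of a b] mk_set_eqI by blast+

lemma mk_set_singleton [simp]:
  fixes a :: "'v::set_universe"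
  shows "is_set (mk_set {a})" "elts (mk_set {a}) = {a}"
  using mk_set_doubleton[of a a] by simp_all

lemma opair_eq_iff [simp]:
  fixes a b c d :: "'v::set_universe"
  shows "\<langle>a, b\<rangle> = \<langle>c, d\<rangle> \<longleftrightarrow> a = c \<and> b = d"
proof
  assume "\<langle>a, b\<rangle> = \<langle>c, d\<rangle>"
  then have "{mk_set {a}, mk_set {a, b}} = {mk_set {c}, mk_set {c, d}}"
    unfolding opair_def by (metis mk_set_doubleton(2))
  then have "(\<lambda>x. elts x) ` {mk_set {a}, mk_set {a, b}} = elts ` {mk_set {c}, mk_set {c, d}}"
    by simp
  then have "{{a}, {a, b}} = {{c}, {c, d}}"
    by simp
  then show "a = c \<and> b = d"
    by (auto simp: doubleton_eq_iff)
qed simp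


section \<open>Superstructures\<close>

definition base_set :: "'v::set_universe \<Rightarrow> bool" where
  "base_set S \<longleftrightarrow> is_set S \<and> infinite (elts S) \<and> (\<forall>s\<in>elts S. \<not> is_set s)"

primrec level :: "'v::set_universe \<Rightarrow> nat \<Rightarrow> 'v set" where
  "level S 0 = elts S"
| "level S (Suc n) = level S n \<union> {x. is_set x \<and> elts x \<subseteq> level S n}"

definition hat :: "'v::set_universe \<Rightarrow> 'v set" where
  "hat S = (\<Union>n. level S n)"


section \<open>Formulas\<close>

datatype 'c trm = Var nat | Cst 'c | PairT "'c trm" "'c trm" | AppT "'c trm" "'c trm"

datatype 'c fm =
    EqF "'c trm" "'c trm"
  | InF "'c trm" "'c trm"
  | NotF "'c fm"
  | AndF "'c fm" "'c fm"
  | AllF nat "'c trm" "'c fm"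

primrec fv_trm :: "'c trm \<Rightarrow> nat set" where
  "fv_trm (Var i) = {i}"
| "fv_trm (Cst c) = {}"
| "fv_trm (PairT s t) = fv_trm s \<union> fv_trm t"
| "fv_trm (AppT s t) = fv_trm s \<union> fv_trm t"

primrec fv :: "'c fm \<Rightarrow> nat set" where
  "fv (EqF s t) = fv_trm s \<union> fv_trm t"
| "fv (InF s t) = fv_trm s \<union> fv_trm t"
| "fv (NotF p) = fv p"
| "fv (AndF p q) = fv p \<union> fv q"
| "fv (AllF i t p) = fv_trm t \<union> (fv p - {i})"

primrec val :: "(nat \<Rightarrow> 'v::set_universe) \<Rightarrow> 'v trm \<Rightarrow> 'v" where
  "val e (Var i) = e i"
| "val e (Cst c) = c"
| "val e (PairT s t) = \<langle>val e s, val e t\<rangle>"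
| "val e (AppT s t) = val e s \<cdot> val e t"

primrec sat :: "(nat \<Rightarrow> 'v::set_universe) \<Rightarrow> 'v fm \<Rightarrow> bool" where
  "sat e (EqF s t) \<longleftrightarrow> val e s = val e t"
| "sat e (InF s t) \<longleftrightarrow> val e s \<in> elts (val e t)"
| "sat e (NotF p) \<longleftrightarrow> \<not> sat e p"
| "sat e (AndF p q) \<longleftrightarrow> sat e p \<and> sat e q"
| "sat e (AllF i t p) \<longleftrightarrow> (\<forall>a\<in>elts (val e t). sat (e(i := a)) p)"

text \<open>\<open>set_fm p\<close> is the set of constants of \<open>p\<close>, and \<open>map_fm star p\<close> replaces each of them by
  its image under \<open>star\<close>.\<close>

definition formula_in :: "'v::set_universe \<Rightarrow> 'v fm \<Rightarrow> bool" where
  "formula_in S p \<longleftrightarrow> set_fm p \<subseteq> hat S"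

definition true_statement :: "'v::set_universe fm \<Rightarrow> bool" where
  "true_statement p \<longleftrightarrow> (\<forall>e. sat e p)"


section \<open>Enlargements\<close>

definition internal :: "'v::set_universe \<Rightarrow> ('v \<Rightarrow> 'v) \<Rightarrow> 'v \<Rightarrow> bool" where
  "internal S star x \<longleftrightarrow> (\<exists>A \<in> hat S - elts S. x \<in> elts (star A))"

text \<open>An index set of cardinality at most that of \<open>hat S\<close> can be taken in the type \<open>'v\<close>.\<close>

definition saturated :: "'v::set_universe \<Rightarrow> ('v \<Rightarrow> 'v) \<Rightarrow> bool" where
  "saturated S star \<longleftrightarrow>
     (\<forall>(I :: 'v set) (U :: 'v \<Rightarrow> 'v).
        I \<noteq> {} \<and> I \<lesssim> hat S \<and>
        (\<forall>i\<in>I. is_set (U i) \<and> elts (U i) \<noteq> {} \<and> internal S star (U i)) \<and>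
        (\<forall>J\<subseteq>I. finite J \<and> J \<noteq> {} \<longrightarrow> (\<Inter>i\<in>J. elts (U i)) \<noteq> {})
        \<longrightarrow> (\<Inter>i\<in>I. elts (U i)) \<noteq> {})"

definition enlargement :: "'v::set_universe \<Rightarrow> 'v \<Rightarrow> ('v \<Rightarrow> 'v) \<Rightarrow> bool" where
  "enlargement S W star \<longleftrightarrow>
     base_set S \<and> base_set W \<and> star ` hat S \<subseteq> hat W \<and>
     star S = W \<and>
     (\<forall>s\<in>elts S. star s = s) \<and>
     (\<forall>p. formula_in S p \<and> fv p = {} \<longrightarrow>
        (true_statement p \<longleftrightarrow> true_statement (map_fm star p))) \<and>
     saturated S star"


section \<open>Small categories\<close>

datatype 'v cat = Cat (Mor: 'v) (Src: 'v) (Tgt: 'v) (Cmp: 'v)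

text \<open>\<open>composes C f g h\<close> means that \<open>h\<close> is \<open>f\<close> after \<open>g\<close>.\<close>

definition composes :: "'v::set_universe cat \<Rightarrow> 'v \<Rightarrow> 'v \<Rightarrow> 'v \<Rightarrow> bool" where
  "composes C f g h \<longleftrightarrow> \<langle>f, g, h\<rangle> \<in> elts (Cmp C)"

definition category :: "'v::set_universe cat \<Rightarrow> bool" where
  "category C \<longleftrightarrow>
     is_set (Mor C) \<and> is_map (Src C) (Mor C) (Mor C) \<and> is_map (Tgt C) (Mor C) (Mor C) \<and>
     is_set (Cmp C) \<and>
     elts (Cmp C) \<subseteq>
       {\<langle>f, g, h\<rangle> | f g h. f \<in> elts (Mor C) \<and> g \<in> elts (Mor C) \<and> h \<in> elts (Mor C)} \<and>
     (\<forall>f\<in>elts (Mor C).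
        Src C \<cdot> (Src C \<cdot> f) = Src C \<cdot> f \<and> Tgt C \<cdot> (Src C \<cdot> f) = Src C \<cdot> f \<and>
        Src C \<cdot> (Tgt C \<cdot> f) = Tgt C \<cdot> f \<and> Tgt C \<cdot> (Tgt C \<cdot> f) = Tgt C \<cdot> f) \<and>
     (\<forall>f\<in>elts (Mor C). \<forall>g\<in>elts (Mor C).
        (\<exists>h. composes C f g h) \<longleftrightarrow> Src C \<cdot> f = Tgt C \<cdot> g) \<and>
     (\<forall>f g h h'. composes C f g h \<and> composes C f g h' \<longrightarrow> h = h') \<and>
     (\<forall>f g h. composes C f g h \<longrightarrow> Src C \<cdot> h = Src C \<cdot> g \<and> Tgt C \<cdot> h = Tgt C \<cdot> f) \<and>
     (\<forall>f\<in>elts (Mor C). composes C f (Src C \<cdot> f) f \<and> composes C (Tgt C \<cdot> f) f f) \<and>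
     (\<forall>f g h a b d.
        composes C f g a \<and> composes C g h b \<and> composes C a h d \<longrightarrow> composes C f b d)"

definition small_category :: "'v::set_universe \<Rightarrow> 'v cat \<Rightarrow> bool" where
  "small_category S C \<longleftrightarrow> category C \<and> Mor C \<in> hat S - elts S"

definition Ob :: "'v::set_universe cat \<Rightarrow> 'v" where
  "Ob C = mk_set {Src C \<cdot> f | f. f \<in> elts (Mor C)}"

definition Hom :: "'v::set_universe cat \<Rightarrow> 'v \<Rightarrow> 'v \<Rightarrow> 'v" where
  "Hom C X Y = mk_set {f \<in> elts (Mor C). Src C \<cdot> f = X \<and> Tgt C \<cdot> f = Y}"

definition opcat :: "'v::set_universe cat \<Rightarrow> 'v cat" where
  "opcat C = Cat (Mor C) (Tgt C) (Src C) (mk_set {\<langle>g, f, h\<rangle> | f g h. composes C f g h})"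

abbreviation star_cat :: "('v \<Rightarrow> 'v) \<Rightarrow> 'v cat \<Rightarrow> 'v cat" where
  "star_cat star C \<equiv> map_cat star C"

definition is_functor :: "'v::set_universe cat \<Rightarrow> 'v cat \<Rightarrow> 'v \<Rightarrow> bool" where
  "is_functor C D F \<longleftrightarrow>
     is_map F (Mor C) (Mor D) \<and>
     (\<forall>f\<in>elts (Mor C). F \<cdot> (Src C \<cdot> f) = Src D \<cdot> (F \<cdot> f) \<and> F \<cdot> (Tgt C \<cdot> f) = Tgt D \<cdot> (F \<cdot> f)) \<and>
     (\<forall>f g h. composes C f g h \<longrightarrow> composes D (F \<cdot> f) (F \<cdot> g) (F \<cdot> h))"

text \<open>Objects are identity morphisms, so \<open>F \<cdot> Y\<close> is also the identity of the object \<open>F \<cdot> Y\<close>.\<close>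

definition functor_morphism :: "'v::set_universe cat \<Rightarrow> 'v cat \<Rightarrow> 'v \<Rightarrow> 'v \<Rightarrow> 'v \<Rightarrow> bool" where
  "functor_morphism C D F G \<tau> \<longleftrightarrow>
     is_map \<tau> (Ob C) (Mor D) \<and>
     (\<forall>Y\<in>elts (Ob C). Src D \<cdot> (\<tau> \<cdot> Y) = F \<cdot> Y \<and> Tgt D \<cdot> (\<tau> \<cdot> Y) = G \<cdot> Y) \<and>
     (\<forall>f\<in>elts (Mor C).
        \<exists>h. composes D (G \<cdot> f) (\<tau> \<cdot> (Src C \<cdot> f)) h \<and> composes D (\<tau> \<cdot> (Tgt C \<cdot> f)) (F \<cdot> f) h)"

definition functor_isomorphism :: "'v::set_universe cat \<Rightarrow> 'v cat \<Rightarrow> 'v \<Rightarrow> 'v \<Rightarrow> 'v \<Rightarrow> bool" where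
  "functor_isomorphism C D F G \<tau> \<longleftrightarrow>
     functor_morphism C D F G \<tau> \<and>
     (\<exists>\<sigma>. functor_morphism C D G F \<sigma> \<and>
        (\<forall>Y\<in>elts (Ob C). composes D (\<sigma> \<cdot> Y) (\<tau> \<cdot> Y) (F \<cdot> Y) \<and>
                         composes D (\<tau> \<cdot> Y) (\<sigma> \<cdot> Y) (G \<cdot> Y)))"


section \<open>Categories of sets and presheaves\<close>

text \<open>
  A morphism of \<open>Ens N\<close> is a triple of source, target and graph.  The object belonging to an
  element \<open>A\<close> of \<open>N\<close> is the identity \<open>id_map A\<close>.
\<close>

definition id_map :: "'v::set_universe \<Rightarrow> 'v" where
  "id_map A = \<langle>A, A, mk_set {\<langle>x, x\<rangle> | x. x \<in> elts A}\<rangle>"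

definition ens_map :: "'v::set_universe \<Rightarrow> 'v \<Rightarrow> 'v \<Rightarrow> 'v \<Rightarrow> bool" where
  "ens_map N A B f \<longleftrightarrow> A \<in> elts N \<and> B \<in> elts N \<and> is_map f A B"

definition Ens :: "'v::set_universe \<Rightarrow> 'v cat" where
  "Ens N = Cat
     (mk_set {\<langle>A, B, f\<rangle> | A B f. ens_map N A B f})
     (mk_set {\<langle>\<langle>A, B, f\<rangle>, id_map A\<rangle> | A B f. ens_map N A B f})
     (mk_set {\<langle>\<langle>A, B, f\<rangle>, id_map B\<rangle> | A B f. ens_map N A B f})
     (mk_set {\<langle>\<langle>B, D, g\<rangle>, \<langle>A, B, f\<rangle>, \<langle>A, D, h\<rangle>\<rangle> | A B D f g h.
        ens_map N A B f \<and> ens_map N B D g \<and> ens_map N A D h \<and>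
        (\<forall>x\<in>elts A. h \<cdot> x = g \<cdot> (f \<cdot> x))})"

definition presheaf :: "'v::set_universe cat \<Rightarrow> 'v \<Rightarrow> 'v \<Rightarrow> bool" where
  "presheaf C N F \<longleftrightarrow> is_functor (opcat C) (Ens N) F"

definition presheaves :: "'v::set_universe cat \<Rightarrow> 'v \<Rightarrow> 'v" where
  "presheaves C N = mk_set {F. presheaf C N F}"

text \<open>\<open>Mor\<^sub>C(_, X)\<close> sends \<open>f : A \<rightarrow> B\<close> to precomposition with \<open>f\<close>, from \<open>Hom C B X\<close> to \<open>Hom C A X\<close>.\<close>

definition yoneda :: "'v::set_universe cat \<Rightarrow> 'v \<Rightarrow> 'v" where
  "yoneda C X = mk_set
     {\<langle>f, \<langle>Hom C (Tgt C \<cdot> f) X, Hom C (Src C \<cdot> f) X,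
          mk_set {\<langle>g, h\<rangle> | g h. g \<in> elts (Hom C (Tgt C \<cdot> f) X) \<and> composes C g f h}\<rangle>\<rangle>
      | f. f \<in> elts (Mor C)}"

text \<open>
  The values of \<open>yoneda C X\<close> are subsets of \<open>Mor C\<close>, which need not be elements of \<open>N\<close> even if
  \<open>Mor C\<close> is a subset of \<open>N\<close>.  An isomorphism between a presheaf with values in \<open>Ens N\<close> and
  \<open>yoneda C X\<close> is therefore taken in a category of sets containing the values of both.  If all
  sets \<open>Hom C Y X\<close> are elements of \<open>N\<close>, this is the same as an isomorphism of functors to \<open>Ens N\<close>.
\<close>

definition representation :: "'v::set_universe cat \<Rightarrow> 'v \<Rightarrow> 'v \<Rightarrow> 'v \<Rightarrow> 'v \<Rightarrow> bool" where
  "representation C N F X \<tau> \<longleftrightarrow>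
     functor_isomorphism (opcat C) (Ens (set_union N (power_set (Mor C)))) F (yoneda C X) \<tau>"

definition representable_by :: "'v::set_universe cat \<Rightarrow> 'v \<Rightarrow> 'v \<Rightarrow> 'v \<Rightarrow> bool" where
  "representable_by C N F X \<longleftrightarrow> X \<in> elts (Ob C) \<and> (\<exists>\<tau>. representation C N F X \<tau>)"

definition representable :: "'v::set_universe cat \<Rightarrow> 'v \<Rightarrow> 'v \<Rightarrow> bool" where
  "representable C N F \<longleftrightarrow> (\<exists>X. representable_by C N F X)"


section \<open>Internal presheaves\<close>

definition internal_presheaf ::
    "'v::set_universe \<Rightarrow> ('v \<Rightarrow> 'v) \<Rightarrow> 'v cat \<Rightarrow> 'v \<Rightarrow> 'v \<Rightarrow> bool" where
  "internal_presheaf S star C N F \<longleftrightarrow>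
     internal S star F \<and> is_functor (opcat (star_cat star C)) (star_cat star (Ens N)) F"

definition internally_representable_by ::
    "'v::set_universe \<Rightarrow> ('v \<Rightarrow> 'v) \<Rightarrow> 'v cat \<Rightarrow> 'v \<Rightarrow> 'v \<Rightarrow> 'v \<Rightarrow> bool" where
  "internally_representable_by S star C N F X \<longleftrightarrow>
     X \<in> elts (Ob (star_cat star C)) \<and>
     (\<exists>\<tau>. internal S star \<tau> \<and> representation (star_cat star C) (star N) F X \<tau>)"

text \<open>
  Formulas in two free variables: variable 0 stands for the presheaf \<open>F\<close>, variable 1 for the
  object \<open>X\<close>.
\<close>

definition assign :: "'v \<Rightarrow> 'v \<Rightarrow> nat \<Rightarrow> 'v" where
  "assign F X = (\<lambda>i. if i = 0 then F else X)"

text \<open>\<open>\<psi>\<close> is a formalization of "\<open>F\<close> is representable by \<open>X\<close>" as a formula in \<open>hat S\<close>.\<close>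

definition says_representable ::
    "'v::set_universe \<Rightarrow> 'v cat \<Rightarrow> 'v \<Rightarrow> 'v fm \<Rightarrow> bool" where
  "says_representable S C N \<psi> \<longleftrightarrow>
     formula_in S \<psi> \<and> fv \<psi> \<subseteq> {0, 1} \<and>
     (\<forall>F\<in>elts (presheaves C N). \<forall>X\<in>elts (Ob C).
        sat (assign F X) \<psi> \<longleftrightarrow> representable_by C N F X)"

definition representability_formula ::
    "'v::set_universe cat \<Rightarrow> 'v \<Rightarrow> 'v fm \<Rightarrow> 'v fm" where
  "representability_formula C N \<psi> =
     AndF (InF (Var 0) (Cst (presheaves C N))) (AndF (InF (Var 1) (Cst (Ob C))) \<psi>)"

end

theory Submission
  imports Defs
begin

text \<open>
  The only property of the enlargement that is used is the transfer principle; everything reduces to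
  writing the notions involved as formulas with bounded quantifiers.  This is organized by the
  relation \<open>trf\<close>: it holds of two predicates if a single formula in \<open>hat S\<close> expresses the first
  one over \<open>hat S\<close>, and its star-image expresses the second one over \<open>hat W\<close>.  It is closed under
  the connectives, bounded quantifiers and all terms, and contains \<open>is_set x\<close>, since an element of a
  superstructure is a set unless it lies in the base set.  So a transferred statement is
  proved by exhibiting the two sides and applying closure rules.

  Transfer makes \<open>*C\<close> a category with \<open>Ob (*C) = *(Ob C)\<close>, identifies the internal presheaves with
  the elements of \<open>*(presheaves C N)\<close>, and shows that \<open>*(Ens N)\<close> is a subcategory of
  \<open>Ens (*N)\<close> (\<open>star_Ens_subcategory\<close>).  Hence internal presheaves, in particular the
  star-images of presheaves, are presheaves with values in \<open>*N\<close>.  The equation for the Yoneda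
  presheaf is the transfer of an explicit description of its elements (\<open>star_yoneda\<close>).

  For representability the difficulty is that \<open>representation\<close> refers to a full category of sets and
  asks for an inverse morphism, neither of which is internal in the enlargement.  But a morphism of
  presheaves has an inverse iff all its components are bijective (\<open>presheaf_isomorphism_iff\<close>),
  so a representation of \<open>F\<close> by \<open>X\<close> is a family of bijections \<open>F(Y) \<rightarrow> Mor(Y, X)\<close> natural in \<open>Y\<close>
  (\<open>representation_iff\<close>).  For \<open>F\<close> and \<open>\<tau>\<close> in a transitive set \<open>L\<close> all quantifiers in
  this condition may be restricted to \<open>L\<close> (\<open>representation_iff_within\<close>).  For \<open>L\<close> one takes a
  level \<open>S\<^sub>n\<close> of the superstructure with large \<open>n\<close> on the standard side and \<open>*S\<^sub>n\<close>, which is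
  again transitive, on the other side.  As every internal object lies in some \<open>*S\<^sub>n\<close>, any formula
  for representability has a star-image that says that there is an internal representation
  (\<open>star_says_representable\<close>).  The statements about representability are then instances of transfer.
\<close>

section \<open>Sets, products and maps in a set universe\<close>

lemma mk_set_subset:
  fixes x :: "'v::set_universe"
  assumes "A \<subseteq> elts x"
  shows "is_set (mk_set A)" "elts (mk_set A) = A"
proof -
  obtain z where "is_set z" "elts z = A"
    using separation[OF assms] by blast
  then show "is_set (mk_set A)" "elts (mk_set A) = A"
    by (simp_all add: mk_set_eqI)
qed

lemma mk_set_empty [simp]: "is_set (mk_set {})" "elts (mk_set {} :: 'v::set_universe) = {}"
  using mk_set_subset[of "{}"] by auto

lemma power_set [simp]:
  "is_set (power_set A)" "elts (power_set A) = {B. is_set B \<and> elts B \<subseteq> elts A}"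
proof -
  obtain z where "is_set z" "elts z = {B. is_set B \<and> elts B \<subseteq> elts A}"
    using power[of A] by blast
  then show "is_set (power_set A)" "elts (power_set A) = {B. is_set B \<and> elts B \<subseteq> elts A}"
    by (simp_all add: power_set_def mk_set_eqI)
qed

text \<open>The union of the elements of a set.\<close>

definition big_union :: "'v::set_universe \<Rightarrow> 'v" where
  "big_union A = mk_set (\<Union> (elts ` elts A))"

lemma big_union [simp]: "is_set (big_union A)" "elts (big_union A) = \<Union> (elts ` elts A)"
proof -
  obtain z where "is_set z" "elts z = \<Union> (elts ` elts A)"
    using union[of A] by blast
  then show "is_set (big_union A)" "elts (big_union A) = \<Union> (elts ` elts A)"
    by (simp_all add: big_union_def mk_set_eqI)
qed

lemma set_union_eq: "set_union A B = big_union (mk_set {A, B})"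
  unfolding set_union_def big_union_def by simp

lemma set_union [simp]: "is_set (set_union A B)" "elts (set_union A B) = elts A \<union> elts B"
  unfolding set_union_eq by auto

text \<open>The Cartesian product of two sets.\<close>

definition cart :: "'v::set_universe \<Rightarrow> 'v \<Rightarrow> 'v" where
  "cart A B = mk_set {\<langle>x, y\<rangle> | x y. x \<in> elts A \<and> y \<in> elts B}"

lemma cart_subset:
  "{\<langle>x, y\<rangle> | x y. x \<in> elts A \<and> y \<in> elts B} \<subseteq> elts (power_set (power_set (set_union A B)))"
  by (auto simp: opair_def)

lemma cart [simp]:
  "is_set (cart A B)" "elts (cart A B) = {\<langle>x, y\<rangle> | x y. x \<in> elts A \<and> y \<in> elts B}"
  unfolding cart_def using cart_subset by (rule mk_set_subset)+

lemma app_eqI: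
  assumes "\<langle>x, y\<rangle> \<in> elts f" "\<And>y'. \<langle>x, y'\<rangle> \<in> elts f \<Longrightarrow> y' = y"
  shows "f \<cdot> x = y"
proof -
  have "\<exists>!y. \<langle>x, y\<rangle> \<in> elts f"
    using assms by blast
  moreover have "(THE y. \<langle>x, y\<rangle> \<in> elts f) = y"
    using assms by (rule the_equality)
  ultimately show ?thesis
    unfolding app_def by simp
qed

lemma is_mapD:
  assumes "is_map f A B"
  shows "is_set f" "x \<in> elts A \<Longrightarrow> \<langle>x, f \<cdot> x\<rangle> \<in> elts f"
    "x \<in> elts A \<Longrightarrow> f \<cdot> x \<in> elts B"
    "\<langle>x, y\<rangle> \<in> elts f \<Longrightarrow> x \<in> elts A \<and> y \<in> elts B \<and> f \<cdot> x = y"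
    "f \<in> elts (power_set (cart A B))"
proof -
  show "is_set f" and "f \<in> elts (power_set (cart A B))"
    using assms unfolding is_map_def by auto
  have *: "x \<in> elts A \<and> y \<in> elts B \<and> f \<cdot> x = y" if "\<langle>x, y\<rangle> \<in> elts f" for x y
  proof -
    have "x \<in> elts A" "y \<in> elts B"
      using assms that unfolding is_map_def by auto
    then show ?thesis
      using assms that unfolding is_map_def by (auto intro!: app_eqI)
  qed
  then show "\<langle>x, y\<rangle> \<in> elts f \<Longrightarrow> x \<in> elts A \<and> y \<in> elts B \<and> f \<cdot> x = y" .
  assume x: "x \<in> elts A"
  then obtain y where "\<langle>x, y\<rangle> \<in> elts f"
    using assms unfolding is_map_def by blast
  with *[OF this] show "\<langle>x, f \<cdot> x\<rangle> \<in> elts f" "f \<cdot> x \<in> elts B"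
    by auto
qed

lemma is_map_elts:
  assumes "is_map f A B"
  shows "elts f = {\<langle>x, f \<cdot> x\<rangle> | x. x \<in> elts A}"
proof -
  have "\<exists>x y. z = \<langle>x, y\<rangle>" if "z \<in> elts f" for z
    using assms that unfolding is_map_def by auto
  then show ?thesis
    using is_mapD[OF assms] by fastforce
qed

text \<open>The codomain of a map is not part of it, so it can be exchanged.\<close>

lemma is_map_cod:
  assumes "is_map f A B" "\<And>x. x \<in> elts A \<Longrightarrow> f \<cdot> x \<in> elts B'"
  shows "is_map f A B'"
proof -
  have "\<exists>!y. \<langle>x, y\<rangle> \<in> elts f" if "x \<in> elts A" for x
    using assms(1) that by (auto simp: is_map_def)
  then show ?thesis
    unfolding is_map_def using assms(2) is_mapD(1)[OF assms(1)]
    by (auto simp: is_map_elts[OF assms(1)])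
qed

text \<open>\<open>lam A b\<close> is the map \<open>x \<mapsto> b x\<close> on \<open>A\<close>; \<open>b\<close> must take the elements of \<open>A\<close> into some set.\<close>

definition lam :: "'v::set_universe \<Rightarrow> ('v \<Rightarrow> 'v) \<Rightarrow> 'v" where
  "lam A b = mk_set {\<langle>x, b x\<rangle> | x. x \<in> elts A}"

lemma lam:
  assumes "\<And>x. x \<in> elts A \<Longrightarrow> b x \<in> elts B"
  shows "is_map (lam A b) A B" "x \<in> elts A \<Longrightarrow> lam A b \<cdot> x = b x"
    "elts (lam A b) = {\<langle>x, b x\<rangle> | x. x \<in> elts A}"
proof -
  have "{\<langle>x, b x\<rangle> | x. x \<in> elts A} \<subseteq> elts (cart A B)"
    using assms by auto
  note * = mk_set_subset[OF this, folded lam_def]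
  then show "elts (lam A b) = {\<langle>x, b x\<rangle> | x. x \<in> elts A}"
    by simp
  show "is_map (lam A b) A B"
    unfolding is_map_def using * assms by auto
  show "x \<in> elts A \<Longrightarrow> lam A b \<cdot> x = b x"
    by (rule app_eqI) (auto simp: *)
qed


section \<open>Categories of sets\<close>

text \<open>The source set and the graph of a triple \<open>\<langle>A, B, f\<rangle>\<close>.\<close>

definition dom_set :: "'v::set_universe \<Rightarrow> 'v" where
  "dom_set m = (THE A. \<exists>B f. m = \<langle>A, B, f\<rangle>)"

definition graph :: "'v::set_universe \<Rightarrow> 'v" where
  "graph m = (THE f. \<exists>A B. m = \<langle>A, B, f\<rangle>)"

lemma dom_set_triple [simp]: "dom_set \<langle>A, B, f\<rangle> = A"
  unfolding dom_set_def by auto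

lemma graph_triple [simp]: "graph \<langle>A, B, f\<rangle> = f"
  unfolding graph_def by auto

lemma id_map_lam: "id_map A = \<langle>A, A, lam A (\<lambda>x. x)\<rangle>"
  unfolding id_map_def lam_def by simp

lemma id_map_eq_iff [simp]: "id_map A = id_map B \<longleftrightarrow> A = B"
  unfolding id_map_def by auto

lemma ens_map_id: "A \<in> elts N \<Longrightarrow> ens_map N A A (lam A (\<lambda>x. x))"
  unfolding ens_map_def by (auto intro: lam)

lemma ens_map_graph: "ens_map N A B f \<Longrightarrow> f \<in> elts (power_set (cart (big_union N) (big_union N)))"
  unfolding ens_map_def is_map_def by simp blast

lemma Mor_Ens_subset:
  "{\<langle>A, B, f\<rangle> | A B f. ens_map N A B f} \<subseteq>
     elts (cart (cart N N) (power_set (cart (big_union N) (big_union N))))"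
proof -
  have "\<langle>A, B, f\<rangle> \<in> elts (cart (cart N N) (power_set (cart (big_union N) (big_union N))))"
    if "ens_map N A B f" for A B f
    using ens_map_graph[OF that] that unfolding cart(2)[of "cart N N"] by (auto simp: ens_map_def)
  then show ?thesis by blast
qed

lemma Mor_Ens [simp]:
  "is_set (Mor (Ens N))" "elts (Mor (Ens N)) = {\<langle>A, B, f\<rangle> | A B f. ens_map N A B f}"
  unfolding Ens_def using mk_set_subset[OF Mor_Ens_subset[of N]] by auto

lemma Src_Ens_subset:
  "{\<langle>\<langle>A, B, f\<rangle>, id_map A\<rangle> | A B f. ens_map N A B f} \<subseteq> elts (cart (Mor (Ens N)) (Mor (Ens N)))"
  "{\<langle>\<langle>A, B, f\<rangle>, id_map B\<rangle> | A B f. ens_map N A B f} \<subseteq> elts (cart (Mor (Ens N)) (Mor (Ens N)))"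
proof -
  have "id_map A \<in> elts (Mor (Ens N))" if "A \<in> elts N" for A
    using ens_map_id[OF that] unfolding id_map_lam by simp
  then show
    "{\<langle>\<langle>A, B, f\<rangle>, id_map A\<rangle> | A B f. ens_map N A B f} \<subseteq> elts (cart (Mor (Ens N)) (Mor (Ens N)))"
    "{\<langle>\<langle>A, B, f\<rangle>, id_map B\<rangle> | A B f. ens_map N A B f} \<subseteq> elts (cart (Mor (Ens N)) (Mor (Ens N)))"
    by (auto simp: ens_map_def simp del: Mor_Ens(2)) (auto simp: ens_map_def)
qed

lemma Src_Ens:
  "is_set (Src (Ens N))" "elts (Src (Ens N)) = {\<langle>\<langle>A, B, f\<rangle>, id_map A\<rangle> | A B f. ens_map N A B f}"
  "ens_map N A B f \<Longrightarrow> Src (Ens N) \<cdot> \<langle>A, B, f\<rangle> = id_map A"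
  using mk_set_subset[OF Src_Ens_subset(1)[of N]] by (auto simp: Ens_def intro!: app_eqI)

lemma Tgt_Ens:
  "is_set (Tgt (Ens N))" "elts (Tgt (Ens N)) = {\<langle>\<langle>A, B, f\<rangle>, id_map B\<rangle> | A B f. ens_map N A B f}"
  "ens_map N A B f \<Longrightarrow> Tgt (Ens N) \<cdot> \<langle>A, B, f\<rangle> = id_map B"
  using mk_set_subset[OF Src_Ens_subset(2)[of N]] by (auto simp: Ens_def intro!: app_eqI)

lemma Cmp_Ens_subset:
  "{\<langle>\<langle>B, D, g\<rangle>, \<langle>A, B, f\<rangle>, \<langle>A, D, h\<rangle>\<rangle> | A B D f g h.
        ens_map N A B f \<and> ens_map N B D g \<and> ens_map N A D h \<and>
        (\<forall>x\<in>elts A. h \<cdot> x = g \<cdot> (f \<cdot> x))}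
   \<subseteq> elts (cart (cart (Mor (Ens N)) (Mor (Ens N))) (Mor (Ens N)))"
  by auto

lemma Cmp_Ens:
  "is_set (Cmp (Ens N))"
  "elts (Cmp (Ens N)) = {\<langle>\<langle>B, D, g\<rangle>, \<langle>A, B, f\<rangle>, \<langle>A, D, h\<rangle>\<rangle> | A B D f g h.
        ens_map N A B f \<and> ens_map N B D g \<and> ens_map N A D h \<and>
        (\<forall>x\<in>elts A. h \<cdot> x = g \<cdot> (f \<cdot> x))}"
  using mk_set_subset[OF Cmp_Ens_subset[of N]] by (auto simp: Ens_def)

lemma composes_Ens:
  "composes (Ens N) \<langle>B', D, g\<rangle> \<langle>A, B, f\<rangle> \<langle>A', D', h\<rangle> \<longleftrightarrow>
     B' = B \<and> A' = A \<and> D' = D \<and> ens_map N A B f \<and> ens_map N B D g \<and> ens_map N A D h \<and>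
     (\<forall>x\<in>elts A. h \<cdot> x = g \<cdot> (f \<cdot> x))"
  unfolding composes_def Cmp_Ens by auto

text \<open>\<open>Ens N\<close> is a full subcategory of \<open>Ens N'\<close> if \<open>N\<close> is a subset of \<open>N'\<close>.\<close>

lemma ens_map_mono: "elts N \<subseteq> elts N' \<Longrightarrow> ens_map N A B f \<Longrightarrow> ens_map N' A B f"
  unfolding ens_map_def by blast

lemma is_functor_subcategory:
  assumes "is_functor C D F"
    and "elts (Mor D) \<subseteq> elts (Mor E)"
    and "\<And>m. m \<in> elts (Mor D) \<Longrightarrow> Src D \<cdot> m = Src E \<cdot> m \<and> Tgt D \<cdot> m = Tgt E \<cdot> m"
    and "elts (Cmp D) \<subseteq> elts (Cmp E)"
  shows "is_functor C E F"
proof -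
  have F: "is_map F (Mor C) (Mor D)"
    using assms(1) unfolding is_functor_def by blast
  have "is_map F (Mor C) (Mor E)"
    by (rule is_map_cod[OF F]) (use assms(2) is_mapD(3)[OF F] in blast)
  then show ?thesis
    using assms is_mapD(3)[OF F] unfolding is_functor_def composes_def by (metis subsetD)
qed

lemma presheaf_mono:
  assumes "presheaf C N F" "elts N \<subseteq> elts N'"
  shows "presheaf C N' F"
  unfolding presheaf_def
proof (rule is_functor_subcategory[OF assms(1)[unfolded presheaf_def]])
  note mono = ens_map_mono[OF assms(2)]
  show "elts (Mor (Ens N)) \<subseteq> elts (Mor (Ens N'))"
    using mono by auto
  show "elts (Cmp (Ens N)) \<subseteq> elts (Cmp (Ens N'))"
    using mono unfolding Cmp_Ens by blast
  show "Src (Ens N) \<cdot> m = Src (Ens N') \<cdot> m \<and> Tgt (Ens N) \<cdot> m = Tgt (Ens N') \<cdot> m"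
    if "m \<in> elts (Mor (Ens N))" for m
    using that mono by (auto simp: Src_Ens Tgt_Ens)
qed

section \<open>Categories and presheaves\<close>

lemma category_map:
  assumes "category C" "f \<in> elts (Mor C)"
  shows "Src C \<cdot> f \<in> elts (Mor C)" "Tgt C \<cdot> f \<in> elts (Mor C)"
proof -
  have "is_map (Src C) (Mor C) (Mor C)" "is_map (Tgt C) (Mor C) (Mor C)"
    using assms(1) unfolding category_def by blast+
  then show "Src C \<cdot> f \<in> elts (Mor C)" "Tgt C \<cdot> f \<in> elts (Mor C)"
    using assms(2) is_mapD(3) by blast+
qed

lemma category_id:
  assumes "category C" "f \<in> elts (Mor C)"
  shows "Src C \<cdot> (Src C \<cdot> f) = Src C \<cdot> f" "Tgt C \<cdot> (Src C \<cdot> f) = Src C \<cdot> f"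
    "Src C \<cdot> (Tgt C \<cdot> f) = Tgt C \<cdot> f" "Tgt C \<cdot> (Tgt C \<cdot> f) = Tgt C \<cdot> f"
  using assms unfolding category_def by blast+

lemma composes_in_Mor:
  assumes "category C" "composes C f g h"
  shows "f \<in> elts (Mor C)" "g \<in> elts (Mor C)" "h \<in> elts (Mor C)"
proof -
  have "\<langle>f, g, h\<rangle> \<in> {\<langle>f, g, h\<rangle> | f g h.
      f \<in> elts (Mor C) \<and> g \<in> elts (Mor C) \<and> h \<in> elts (Mor C)}"
    using assms unfolding category_def composes_def by blast
  then show "f \<in> elts (Mor C)" "g \<in> elts (Mor C)" "h \<in> elts (Mor C)"
    by auto
qed

text \<open>The composite \<open>f\<close> after \<open>g\<close>; meaningful only if the source of \<open>f\<close> is the target of \<open>g\<close>.\<close>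

definition comp_of :: "'v::set_universe cat \<Rightarrow> 'v \<Rightarrow> 'v \<Rightarrow> 'v" where
  "comp_of C f g = (THE h. composes C f g h)"

lemma composes_iff:
  assumes "category C"
  shows "composes C f g h \<longleftrightarrow>
    f \<in> elts (Mor C) \<and> g \<in> elts (Mor C) \<and> Src C \<cdot> f = Tgt C \<cdot> g \<and> h = comp_of C f g"
proof -
  have *: "comp_of C f g = h" if "composes C f g h" for h
    unfolding comp_of_def
  proof (rule the_equality)
    show "h' = h" if "composes C f g h'" for h'
      using assms that \<open>composes C f g h\<close> unfolding category_def by blast
  qed fact
  have "(\<exists>h. composes C f g h) \<longleftrightarrow> Src C \<cdot> f = Tgt C \<cdot> g"
    if "f \<in> elts (Mor C)" "g \<in> elts (Mor C)"
    using assms that unfolding category_def by blast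
  then show ?thesis
    using * composes_in_Mor[OF assms] by blast
qed

lemma comp_of:
  assumes "category C" "f \<in> elts (Mor C)" "g \<in> elts (Mor C)" "Src C \<cdot> f = Tgt C \<cdot> g"
  shows "comp_of C f g \<in> elts (Mor C)" "Src C \<cdot> comp_of C f g = Src C \<cdot> g"
    "Tgt C \<cdot> comp_of C f g = Tgt C \<cdot> f"
proof -
  have *: "composes C f g (comp_of C f g)"
    using assms composes_iff by blast
  then show "comp_of C f g \<in> elts (Mor C)"
    by (rule composes_in_Mor(3)[OF assms(1)])
  show "Src C \<cdot> comp_of C f g = Src C \<cdot> g" "Tgt C \<cdot> comp_of C f g = Tgt C \<cdot> f"
    using assms(1) * unfolding category_def by blast+
qed

lemma comp_of_id:
  assumes "category C" "f \<in> elts (Mor C)"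
  shows "comp_of C f (Src C \<cdot> f) = f" "comp_of C (Tgt C \<cdot> f) f = f"
proof -
  have "composes C f (Src C \<cdot> f) f" "composes C (Tgt C \<cdot> f) f f"
    using assms unfolding category_def by blast+
  then show "comp_of C f (Src C \<cdot> f) = f" "comp_of C (Tgt C \<cdot> f) f = f"
    using composes_iff[OF assms(1)] by auto
qed

lemma comp_of_assoc:
  assumes "category C" "f \<in> elts (Mor C)" "g \<in> elts (Mor C)" "h \<in> elts (Mor C)"
    and "Src C \<cdot> f = Tgt C \<cdot> g" "Src C \<cdot> g = Tgt C \<cdot> h"
  shows "comp_of C (comp_of C f g) h = comp_of C f (comp_of C g h)"
proof -
  have "composes C f g (comp_of C f g)" "composes C g h (comp_of C g h)"
    "composes C (comp_of C f g) h (comp_of C (comp_of C f g) h)"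
    using assms comp_of[OF assms(1)] by (auto simp: composes_iff[OF assms(1)])
  then have "composes C f (comp_of C g h) (comp_of C (comp_of C f g) h)"
    using assms(1) unfolding category_def by blast
  then show ?thesis
    using composes_iff[OF assms(1)] by auto
qed

lemma Ob:
  assumes "category C"
  shows "is_set (Ob C)" "elts (Ob C) = {f \<in> elts (Mor C). Src C \<cdot> f = f}"
    "Y \<in> elts (Ob C) \<Longrightarrow> Y \<in> elts (Mor C) \<and> Src C \<cdot> Y = Y \<and> Tgt C \<cdot> Y = Y"
    "f \<in> elts (Mor C) \<Longrightarrow> Src C \<cdot> f \<in> elts (Ob C) \<and> Tgt C \<cdot> f \<in> elts (Ob C)"
proof -
  note category_map[OF assms, simp] category_id[OF assms, simp]
  have "{Src C \<cdot> f | f. f \<in> elts (Mor C)} \<subseteq> elts (Mor C)"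
    by auto
  note * = mk_set_subset[OF this, folded Ob_def]
  show "is_set (Ob C)"
    by (rule *)
  show **: "elts (Ob C) = {f \<in> elts (Mor C). Src C \<cdot> f = f}"
    unfolding * by force
  show "Y \<in> elts (Ob C) \<Longrightarrow> Y \<in> elts (Mor C) \<and> Src C \<cdot> Y = Y \<and> Tgt C \<cdot> Y = Y"
    unfolding * by auto
  show "f \<in> elts (Mor C) \<Longrightarrow> Src C \<cdot> f \<in> elts (Ob C) \<and> Tgt C \<cdot> f \<in> elts (Ob C)"
    unfolding ** by simp
qed

lemma Hom [simp]:
  "is_set (Hom C X Y)"
  "elts (Hom C X Y) = {f \<in> elts (Mor C). Src C \<cdot> f = X \<and> Tgt C \<cdot> f = Y}"
  unfolding Hom_def by (rule mk_set_subset[of _ "Mor C"]; blast)+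

lemma opcat_simps [simp]: "Mor (opcat C) = Mor C" "Src (opcat C) = Tgt C" "Tgt (opcat C) = Src C"
  unfolding opcat_def by simp_all

lemma Ob_opcat: "category C \<Longrightarrow> Ob (opcat C) = Ob C"
  unfolding Ob_def opcat_simps by (rule arg_cong[of _ _ mk_set]) (metis category_id category_map)

lemma composes_opcat:
  assumes "category C"
  shows "composes (opcat C) f g h \<longleftrightarrow> composes C g f h"
proof -
  have "{\<langle>g, f, h\<rangle> | f g h. composes C f g h} \<subseteq> elts (cart (cart (Mor C) (Mor C)) (Mor C))"
    using composes_in_Mor[OF assms] by auto
  note * = mk_set_subset[OF this]
  show ?thesis
    unfolding composes_def[of "opcat C"] unfolding opcat_def by (simp add: *)
qed

lemma contravariant_functor_iff:
  assumes "category C"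
  shows "is_functor (opcat C) D F \<longleftrightarrow>
    is_map F (Mor C) (Mor D) \<and>
    (\<forall>f\<in>elts (Mor C). F \<cdot> (Tgt C \<cdot> f) = Src D \<cdot> (F \<cdot> f) \<and> F \<cdot> (Src C \<cdot> f) = Tgt D \<cdot> (F \<cdot> f)) \<and>
    (\<forall>f g h. composes C f g h \<longrightarrow> composes D (F \<cdot> g) (F \<cdot> f) (F \<cdot> h))"
  unfolding is_functor_def opcat_simps composes_opcat[OF assms] by blast

text \<open>
  The set \<open>F(Y)\<close> for a presheaf \<open>F\<close> and an object \<open>Y\<close>, and the value at \<open>a\<close> of the map \<open>F(k)\<close>
  for a morphism \<open>k\<close>.  The latter is also used for the components of morphisms of presheaves.
\<close>

definition fib :: "'v::set_universe \<Rightarrow> 'v \<Rightarrow> 'v" where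
  "fib F Y = dom_set (F \<cdot> Y)"

definition act :: "'v::set_universe \<Rightarrow> 'v \<Rightarrow> 'v \<Rightarrow> 'v" where
  "act F k a = graph (F \<cdot> k) \<cdot> a"

lemma presheaf_arrow:
  assumes "category C" "presheaf C N F" "k \<in> elts (Mor C)"
  shows "F \<cdot> k = \<langle>fib F (Tgt C \<cdot> k), fib F (Src C \<cdot> k), graph (F \<cdot> k)\<rangle>"
    "ens_map N (fib F (Tgt C \<cdot> k)) (fib F (Src C \<cdot> k)) (graph (F \<cdot> k))"
    "F \<cdot> (Tgt C \<cdot> k) = id_map (fib F (Tgt C \<cdot> k))"
    "a \<in> elts (fib F (Tgt C \<cdot> k)) \<Longrightarrow> act F k a \<in> elts (fib F (Src C \<cdot> k))"
proof -
  note F = assms(2)[unfolded presheaf_def contravariant_functor_iff[OF assms(1)]]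
  have "F \<cdot> k \<in> elts (Mor (Ens N))"
    using F assms(3) is_mapD(3) by blast
  then obtain A B f where f: "F \<cdot> k = \<langle>A, B, f\<rangle>" "ens_map N A B f"
    by auto
  then have *: "F \<cdot> (Tgt C \<cdot> k) = id_map A" "F \<cdot> (Src C \<cdot> k) = id_map B"
    using F assms(3) by (auto simp: Src_Ens Tgt_Ens)
  then have "fib F (Tgt C \<cdot> k) = A" "fib F (Src C \<cdot> k) = B"
    unfolding fib_def id_map_def by simp_all
  then show "F \<cdot> k = \<langle>fib F (Tgt C \<cdot> k), fib F (Src C \<cdot> k), graph (F \<cdot> k)\<rangle>"
    "ens_map N (fib F (Tgt C \<cdot> k)) (fib F (Src C \<cdot> k)) (graph (F \<cdot> k))"
    "F \<cdot> (Tgt C \<cdot> k) = id_map (fib F (Tgt C \<cdot> k))"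
    "a \<in> elts (fib F (Tgt C \<cdot> k)) \<Longrightarrow> act F k a \<in> elts (fib F (Src C \<cdot> k))"
    using * f unfolding act_def by (auto simp: ens_map_def dest: is_mapD)
qed

lemma presheaf_object:
  assumes "category C" "presheaf C N F" "Y \<in> elts (Ob C)"
  shows "F \<cdot> Y = id_map (fib F Y)" "fib F Y \<in> elts N"
proof -
  have Y: "Y \<in> elts (Mor C)" "Tgt C \<cdot> Y = Y"
    using Ob(3)[OF assms(1,3)] by auto
  show "F \<cdot> Y = id_map (fib F Y)" "fib F Y \<in> elts N"
    using presheaf_arrow(2,3)[OF assms(1,2) Y(1)] Y(2) by (simp_all add: ens_map_def)
qed


section \<open>The Yoneda presheaf\<close>

lemma yoneda_lam:
  assumes "category C"
  shows "yoneda C X = lam (Mor C) (\<lambda>k. \<langle>Hom C (Tgt C \<cdot> k) X, Hom C (Src C \<cdot> k) X,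
    lam (Hom C (Tgt C \<cdot> k) X) (\<lambda>g. comp_of C g k)\<rangle>)"
proof -
  have "{\<langle>g, h\<rangle> | g h. g \<in> elts (Hom C (Tgt C \<cdot> k) X) \<and> composes C g k h} =
      {\<langle>g, comp_of C g k\<rangle> | g. g \<in> elts (Hom C (Tgt C \<cdot> k) X)}"
    if "k \<in> elts (Mor C)" for k
    using that by (auto simp: composes_iff[OF assms])
  then have eq: "mk_set {\<langle>g, h\<rangle> | g h. g \<in> elts (Hom C (Tgt C \<cdot> k) X) \<and> composes C g k h} =
      lam (Hom C (Tgt C \<cdot> k) X) (\<lambda>g. comp_of C g k)"
    if "k \<in> elts (Mor C)" for k
    unfolding lam_def using that by simp
  show ?thesis
    unfolding yoneda_def lam_def[of "Mor C"]
    by (intro arg_cong[of _ _ mk_set] Collect_cong ex_cong1) (auto simp: eq simp del: Hom(2))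
qed

context
  fixes C :: "'v::set_universe cat" and X :: 'v
  assumes C: "category C"
begin

lemma ens_map_precompose:
  assumes "k \<in> elts (Mor C)"
  shows "ens_map (power_set (Mor C)) (Hom C (Tgt C \<cdot> k) X) (Hom C (Src C \<cdot> k) X)
      (lam (Hom C (Tgt C \<cdot> k) X) (\<lambda>g. comp_of C g k))"
    "g \<in> elts (Hom C (Tgt C \<cdot> k) X) \<Longrightarrow> lam (Hom C (Tgt C \<cdot> k) X) (\<lambda>g. comp_of C g k) \<cdot> g = comp_of C g k"
proof -
  have *: "comp_of C g k \<in> elts (Hom C (Src C \<cdot> k) X)" if "g \<in> elts (Hom C (Tgt C \<cdot> k) X)" for g
    using that comp_of[OF C _ assms] by auto
  show "ens_map (power_set (Mor C)) (Hom C (Tgt C \<cdot> k) X) (Hom C (Src C \<cdot> k) X)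
      (lam (Hom C (Tgt C \<cdot> k) X) (\<lambda>g. comp_of C g k))"
    unfolding ens_map_def
  proof (intro conjI)
    show "is_map (lam (Hom C (Tgt C \<cdot> k) X) (\<lambda>g. comp_of C g k))
        (Hom C (Tgt C \<cdot> k) X) (Hom C (Src C \<cdot> k) X)"
      by (rule lam(1)[OF *])
  qed auto
  show "g \<in> elts (Hom C (Tgt C \<cdot> k) X) \<Longrightarrow>
      lam (Hom C (Tgt C \<cdot> k) X) (\<lambda>g. comp_of C g k) \<cdot> g = comp_of C g k"
    by (rule lam(2)[OF *])
qed

lemma yoneda_map:
  "is_map (yoneda C X) (Mor C) (Mor (Ens (power_set (Mor C))))"
  "k \<in> elts (Mor C) \<Longrightarrow> yoneda C X \<cdot> k = \<langle>Hom C (Tgt C \<cdot> k) X, Hom C (Src C \<cdot> k) X,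
    lam (Hom C (Tgt C \<cdot> k) X) (\<lambda>g. comp_of C g k)\<rangle>"
proof -
  have *: "\<langle>Hom C (Tgt C \<cdot> k) X, Hom C (Src C \<cdot> k) X,
      lam (Hom C (Tgt C \<cdot> k) X) (\<lambda>g. comp_of C g k)\<rangle> \<in> elts (Mor (Ens (power_set (Mor C))))"
    if "k \<in> elts (Mor C)" for k
    using ens_map_precompose(1)[OF that] by auto
  show "is_map (yoneda C X) (Mor C) (Mor (Ens (power_set (Mor C))))"
    unfolding yoneda_lam[OF C] by (rule lam(1)[OF *])
  show "k \<in> elts (Mor C) \<Longrightarrow> yoneda C X \<cdot> k = \<langle>Hom C (Tgt C \<cdot> k) X, Hom C (Src C \<cdot> k) X,
    lam (Hom C (Tgt C \<cdot> k) X) (\<lambda>g. comp_of C g k)\<rangle>"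
    unfolding yoneda_lam[OF C] by (rule lam(2)[OF *])
qed

lemma yoneda_object:
  assumes "Y \<in> elts (Ob C)"
  shows "yoneda C X \<cdot> Y = id_map (Hom C Y X)" "fib (yoneda C X) Y = Hom C Y X"
proof -
  note Y = Ob(3)[OF C assms]
  \<comment> \<open>\<open>Y\<close> is an identity morphism, so precomposition with it changes nothing\<close>
  have "lam (Hom C Y X) (\<lambda>g. comp_of C g Y) = lam (Hom C Y X) (\<lambda>g. g)"
    unfolding lam_def using comp_of_id(1)[OF C] by (intro arg_cong[of _ _ mk_set]) force
  then show "yoneda C X \<cdot> Y = id_map (Hom C Y X)"
    using yoneda_map(2)[of Y] Y by (simp add: id_map_lam)
  then show "fib (yoneda C X) Y = Hom C Y X"
    by (simp add: fib_def id_map_def)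
qed

lemma yoneda_act:
  "k \<in> elts (Mor C) \<Longrightarrow> g \<in> elts (Hom C (Tgt C \<cdot> k) X) \<Longrightarrow> act (yoneda C X) k g = comp_of C g k"
  unfolding act_def using yoneda_map(2) ens_map_precompose(2) by simp

text \<open>Its values are subsets of \<open>Mor C\<close>; functoriality is associativity of composition.\<close>

lemma presheaf_yoneda: "presheaf C (power_set (Mor C)) (yoneda C X)"
  unfolding presheaf_def contravariant_functor_iff[OF C]
proof (intro conjI ballI allI impI)
  show "is_map (yoneda C X) (Mor C) (Mor (Ens (power_set (Mor C))))"
    by (rule yoneda_map)
next
  fix k assume k: "k \<in> elts (Mor C)"
  note st = Ob(4)[OF C k]
  show "yoneda C X \<cdot> (Tgt C \<cdot> k) = Src (Ens (power_set (Mor C))) \<cdot> (yoneda C X \<cdot> k)"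
    using yoneda_object(1)[of "Tgt C \<cdot> k"] st
    by (simp add: yoneda_map(2)[OF k] Src_Ens(3)[OF ens_map_precompose(1)[OF k]])
  show "yoneda C X \<cdot> (Src C \<cdot> k) = Tgt (Ens (power_set (Mor C))) \<cdot> (yoneda C X \<cdot> k)"
    using yoneda_object(1)[of "Src C \<cdot> k"] st
    by (simp add: yoneda_map(2)[OF k] Tgt_Ens(3)[OF ens_map_precompose(1)[OF k]])
next
  fix f g h assume "composes C f g h"
  then have fg: "f \<in> elts (Mor C)" "g \<in> elts (Mor C)" "Src C \<cdot> f = Tgt C \<cdot> g" and h: "h = comp_of C f g"
    using composes_iff[OF C] by auto
  note h' = comp_of[OF C fg, folded h]
  have "comp_of C x h = comp_of C (comp_of C x f) g"
    if "x \<in> elts (Hom C (Tgt C \<cdot> f) X)" for x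
    using that fg by (simp add: h comp_of_assoc[OF C])
  moreover have "comp_of C x f \<in> elts (Hom C (Tgt C \<cdot> g) X)"
    if "x \<in> elts (Hom C (Tgt C \<cdot> f) X)" for x
    using that fg comp_of[OF C _ fg(1), of x] by simp
  ultimately show "composes (Ens (power_set (Mor C))) (yoneda C X \<cdot> g) (yoneda C X \<cdot> f) (yoneda C X \<cdot> h)"
    using fg h' ens_map_precompose[of f] ens_map_precompose[of g] ens_map_precompose[of h]
    by (simp add: yoneda_map(2) composes_Ens del: Hom(2))
qed

end

section \<open>Isomorphisms of presheaves\<close>

text \<open>
  A morphism of presheaves is a family of maps \<open>a \<mapsto> act \<tau> Y a\<close> from \<open>F(Y)\<close> to \<open>G(Y)\<close> that is natural
  in \<open>Y\<close>.
\<close>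

lemma presheaf_morphism_iff:
  assumes C: "category C" and F: "presheaf C N F" and G: "presheaf C N G"
  shows "functor_morphism (opcat C) (Ens N) F G \<tau> \<longleftrightarrow>
    is_map \<tau> (Ob C) (Mor (Ens N)) \<and>
    (\<forall>Y\<in>elts (Ob C). \<tau> \<cdot> Y = \<langle>fib F Y, fib G Y, graph (\<tau> \<cdot> Y)\<rangle>) \<and>
    (\<forall>k\<in>elts (Mor C). \<forall>a\<in>elts (fib F (Tgt C \<cdot> k)).
      act \<tau> (Src C \<cdot> k) (act F k a) = act G k (act \<tau> (Tgt C \<cdot> k) a))"
    (is "?L \<longleftrightarrow> ?map \<and> ?comp \<and> ?nat")
proof -
  have comp: "(Src (Ens N) \<cdot> (\<tau> \<cdot> Y) = F \<cdot> Y \<and> Tgt (Ens N) \<cdot> (\<tau> \<cdot> Y) = G \<cdot> Y) \<longleftrightarrow>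
      \<tau> \<cdot> Y = \<langle>fib F Y, fib G Y, graph (\<tau> \<cdot> Y)\<rangle>"
    if map: ?map and Y: "Y \<in> elts (Ob C)" for Y
  proof -
    have "\<tau> \<cdot> Y \<in> elts (Mor (Ens N))"
      using is_mapD(3)[OF map Y] .
    then obtain A B f where f: "\<tau> \<cdot> Y = \<langle>A, B, f\<rangle>" "ens_map N A B f"
      by auto
    show ?thesis
      unfolding f(1) Src_Ens(3)[OF f(2)] Tgt_Ens(3)[OF f(2)] presheaf_object(1)[OF C F Y]
        presheaf_object(1)[OF C G Y] by simp
  qed
  have nat: "(\<exists>h. composes (Ens N) (G \<cdot> k) (\<tau> \<cdot> (Tgt C \<cdot> k)) h \<and>
        composes (Ens N) (\<tau> \<cdot> (Src C \<cdot> k)) (F \<cdot> k) h) \<longleftrightarrow>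
      (\<forall>a\<in>elts (fib F (Tgt C \<cdot> k)).
        act \<tau> (Src C \<cdot> k) (act F k a) = act G k (act \<tau> (Tgt C \<cdot> k) a))"
    if map: ?map and ?comp and k: "k \<in> elts (Mor C)" for k
  proof -
    note st = Ob(4)[OF C k]
    let ?s = "Src C \<cdot> k" and ?t = "Tgt C \<cdot> k"
    have \<tau>: "\<tau> \<cdot> Y = \<langle>fib F Y, fib G Y, graph (\<tau> \<cdot> Y)\<rangle>"
        "ens_map N (fib F Y) (fib G Y) (graph (\<tau> \<cdot> Y))" if "Y \<in> elts (Ob C)" for Y
    proof -
      show "\<tau> \<cdot> Y = \<langle>fib F Y, fib G Y, graph (\<tau> \<cdot> Y)\<rangle>"
        using \<open>?comp\<close> that by blast
      moreover have "\<tau> \<cdot> Y \<in> elts (Mor (Ens N))"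
        using is_mapD(3)[OF map that] .
      ultimately show "ens_map N (fib F Y) (fib G Y) (graph (\<tau> \<cdot> Y))"
        by auto
    qed
    obtain \<phi> \<gamma> \<alpha> \<beta> where eqs: "F \<cdot> k = \<langle>fib F ?t, fib F ?s, \<phi>\<rangle>" "G \<cdot> k = \<langle>fib G ?t, fib G ?s, \<gamma>\<rangle>"
        "\<tau> \<cdot> ?t = \<langle>fib F ?t, fib G ?t, \<alpha>\<rangle>" "\<tau> \<cdot> ?s = \<langle>fib F ?s, fib G ?s, \<beta>\<rangle>"
      using presheaf_arrow(1)[OF C F k] presheaf_arrow(1)[OF C G k] \<tau>(1) st by blast
    have maps: "ens_map N (fib F ?t) (fib F ?s) \<phi>" "ens_map N (fib G ?t) (fib G ?s) \<gamma>"
        "ens_map N (fib F ?t) (fib G ?t) \<alpha>" "ens_map N (fib F ?s) (fib G ?s) \<beta>"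
      using presheaf_arrow(2)[OF C F k] presheaf_arrow(2)[OF C G k] \<tau>(2) st eqs by fastforce+
    have composite: "composes (Ens N) (G \<cdot> k) (\<tau> \<cdot> ?t) h \<longleftrightarrow>
        (\<exists>h'. h = \<langle>fib F ?t, fib G ?s, h'\<rangle> \<and> ens_map N (fib F ?t) (fib G ?s) h' \<and>
          (\<forall>a\<in>elts (fib F ?t). h' \<cdot> a = \<gamma> \<cdot> (\<alpha> \<cdot> a)))" for h
    proof -
      have "h \<in> elts (Mor (Ens N))" if "composes (Ens N) (G \<cdot> k) (\<tau> \<cdot> ?t) h"
        using that unfolding composes_def Cmp_Ens by auto
      then show ?thesis
        unfolding eqs using maps by (auto simp: composes_Ens)
    qed
    have composite': "composes (Ens N) (\<tau> \<cdot> ?s) (F \<cdot> k) \<langle>fib F ?t, fib G ?s, h'\<rangle> \<longleftrightarrow>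
        ens_map N (fib F ?t) (fib G ?s) h' \<and> (\<forall>a\<in>elts (fib F ?t). h' \<cdot> a = \<beta> \<cdot> (\<phi> \<cdot> a))" for h'
      unfolding eqs using maps by (auto simp: composes_Ens)
    have \<gamma>\<alpha>: "\<gamma> \<cdot> (\<alpha> \<cdot> a) \<in> elts (fib G ?s)" if "a \<in> elts (fib F ?t)" for a
      using maps that unfolding ens_map_def by (blast intro: is_mapD(3))
    have "is_map (lam (fib F ?t) (\<lambda>a. \<gamma> \<cdot> (\<alpha> \<cdot> a))) (fib F ?t) (fib G ?s)"
      by (rule lam(1)[OF \<gamma>\<alpha>])
    then have lam_map: "ens_map N (fib F ?t) (fib G ?s) (lam (fib F ?t) (\<lambda>a. \<gamma> \<cdot> (\<alpha> \<cdot> a)))"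
      using maps unfolding ens_map_def by blast
    have lam_app: "lam (fib F ?t) (\<lambda>a. \<gamma> \<cdot> (\<alpha> \<cdot> a)) \<cdot> a = \<gamma> \<cdot> (\<alpha> \<cdot> a)" if "a \<in> elts (fib F ?t)" for a
      by (rule lam(2)[OF \<gamma>\<alpha> that])
    have "(\<exists>h. composes (Ens N) (G \<cdot> k) (\<tau> \<cdot> ?t) h \<and>
          composes (Ens N) (\<tau> \<cdot> ?s) (F \<cdot> k) h) \<longleftrightarrow>
        (\<forall>a\<in>elts (fib F ?t). \<beta> \<cdot> (\<phi> \<cdot> a) = \<gamma> \<cdot> (\<alpha> \<cdot> a))"
      (is "(\<exists>h. ?P h) \<longleftrightarrow> ?Q")
    proof
      assume "\<exists>h. ?P h"
      then show ?Q
        using composite composite' by auto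
    next
      assume ?Q
      then show "\<exists>h. ?P h"
        using lam_map lam_app
        by (intro exI[of _ "\<langle>fib F ?t, fib G ?s, lam (fib F ?t) (\<lambda>a. \<gamma> \<cdot> (\<alpha> \<cdot> a))\<rangle>"])
          (simp add: composite composite')
    qed
    then show ?thesis
      unfolding act_def by (simp add: eqs)
  qed
  show ?thesis
    unfolding functor_morphism_def opcat_simps Ob_opcat[OF C]
    by (intro conj_cong refl; rule ball_cong[OF refl]) (rule comp nat; assumption)+
qed

text \<open>The inverse of a morphism with bijective components consists of the inverse maps.\<close>

lemma presheaf_isomorphism_iff:
  assumes C: "category C" and F: "presheaf C N F" and G: "presheaf C N G"
  shows "functor_isomorphism (opcat C) (Ens N) F G \<tau> \<longleftrightarrow>
    functor_morphism (opcat C) (Ens N) F G \<tau> \<and>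
    (\<forall>Y\<in>elts (Ob C). bij_betw (act \<tau> Y) (elts (fib F Y)) (elts (fib G Y)))"
proof -
  have inverse: "composes (Ens N) (\<sigma> \<cdot> Y) (\<tau> \<cdot> Y) (F \<cdot> Y) \<longleftrightarrow>
      (\<forall>a\<in>elts (fib F Y). act \<sigma> Y (act \<tau> Y a) = a)"
    if C: "category C" and F: "presheaf C N F" and G: "presheaf C N G"
      and \<tau>: "functor_morphism (opcat C) (Ens N) F G \<tau>"
      and \<sigma>: "functor_morphism (opcat C) (Ens N) G F \<sigma>"
      and Y: "Y \<in> elts (Ob C)" for F G \<sigma> \<tau> Y
  proof -
    note \<tau>' = \<tau>[unfolded presheaf_morphism_iff[OF C F G]]
    note \<sigma>' = \<sigma>[unfolded presheaf_morphism_iff[OF C G F]]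
    have \<tau>Y: "\<tau> \<cdot> Y = \<langle>fib F Y, fib G Y, graph (\<tau> \<cdot> Y)\<rangle>" "\<tau> \<cdot> Y \<in> elts (Mor (Ens N))"
      using \<tau>' Y is_mapD(3) by blast+
    have \<sigma>Y: "\<sigma> \<cdot> Y = \<langle>fib G Y, fib F Y, graph (\<sigma> \<cdot> Y)\<rangle>" "\<sigma> \<cdot> Y \<in> elts (Mor (Ens N))"
      using \<sigma>' Y is_mapD(3) by blast+
    from \<tau>Y \<sigma>Y obtain \<alpha> \<beta> where eqs: "\<tau> \<cdot> Y = \<langle>fib F Y, fib G Y, \<alpha>\<rangle>" "\<sigma> \<cdot> Y = \<langle>fib G Y, fib F Y, \<beta>\<rangle>"
      by blast
    have maps: "ens_map N (fib F Y) (fib G Y) \<alpha>" "ens_map N (fib G Y) (fib F Y) \<beta>"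
      using \<tau>Y(2) \<sigma>Y(2) unfolding eqs by auto
    have "composes (Ens N) (\<sigma> \<cdot> Y) (\<tau> \<cdot> Y) (F \<cdot> Y) \<longleftrightarrow>
        (\<forall>a\<in>elts (fib F Y). lam (fib F Y) (\<lambda>x. x) \<cdot> a = act \<sigma> Y (act \<tau> Y a))"
      unfolding presheaf_object(1)[OF C F Y] id_map_lam act_def
      using maps ens_map_id[OF presheaf_object(2)[OF C F Y]] by (simp add: eqs composes_Ens)
    also have "\<dots> \<longleftrightarrow> (\<forall>a\<in>elts (fib F Y). act \<sigma> Y (act \<tau> Y a) = a)"
      using lam(2)[of "fib F Y" "\<lambda>x. x" "fib F Y"] by auto
    finally show ?thesis .
  qed
  have act_in: "act \<tau> Y a \<in> elts (fib G Y)"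
    if C: "category C" and F: "presheaf C N F" and G: "presheaf C N G"
      and \<tau>: "functor_morphism (opcat C) (Ens N) F G \<tau>"
      and Y: "Y \<in> elts (Ob C)" and a: "a \<in> elts (fib F Y)" for F G \<tau> Y a
  proof -
    note \<tau>' = \<tau>[unfolded presheaf_morphism_iff[OF C F G]]
    have \<tau>Y: "\<tau> \<cdot> Y = \<langle>fib F Y, fib G Y, graph (\<tau> \<cdot> Y)\<rangle>" "\<tau> \<cdot> Y \<in> elts (Mor (Ens N))"
      using \<tau>' Y is_mapD(3) by blast+
    then have "is_map (graph (\<tau> \<cdot> Y)) (fib F Y) (fib G Y)"
      by (auto simp: ens_map_def)
    then show ?thesis
      unfolding act_def using a by (rule is_mapD(3))
  qed
  show ?thesis
  proof
    assume iso: "functor_isomorphism (opcat C) (Ens N) F G \<tau>"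
    then obtain \<sigma> where \<tau>: "functor_morphism (opcat C) (Ens N) F G \<tau>"
      and \<sigma>: "functor_morphism (opcat C) (Ens N) G F \<sigma>"
      and inv: "\<forall>Y\<in>elts (Ob C). composes (Ens N) (\<sigma> \<cdot> Y) (\<tau> \<cdot> Y) (F \<cdot> Y) \<and>
                         composes (Ens N) (\<tau> \<cdot> Y) (\<sigma> \<cdot> Y) (G \<cdot> Y)"
      unfolding functor_isomorphism_def Ob_opcat[OF C] by blast
    have "bij_betw (act \<tau> Y) (elts (fib F Y)) (elts (fib G Y))" if Y: "Y \<in> elts (Ob C)" for Y
    proof (rule bij_betw_byWitness[of _ "act \<sigma> Y"])
      show "\<forall>a\<in>elts (fib F Y). act \<sigma> Y (act \<tau> Y a) = a"
        using inv Y inverse[OF C F G \<tau> \<sigma> Y] by blast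
      show "\<forall>a\<in>elts (fib G Y). act \<tau> Y (act \<sigma> Y a) = a"
        using inv Y inverse[OF C G F \<sigma> \<tau> Y] by blast
    qed (use act_in[OF C F G \<tau> Y] act_in[OF C G F \<sigma> Y] in blast)+
    with \<tau> show "functor_morphism (opcat C) (Ens N) F G \<tau> \<and>
        (\<forall>Y\<in>elts (Ob C). bij_betw (act \<tau> Y) (elts (fib F Y)) (elts (fib G Y)))"
      by blast
  next
    assume "functor_morphism (opcat C) (Ens N) F G \<tau> \<and>
        (\<forall>Y\<in>elts (Ob C). bij_betw (act \<tau> Y) (elts (fib F Y)) (elts (fib G Y)))"
    then have \<tau>: "functor_morphism (opcat C) (Ens N) F G \<tau>"
      and bij: "\<And>Y. Y \<in> elts (Ob C) \<Longrightarrow> bij_betw (act \<tau> Y) (elts (fib F Y)) (elts (fib G Y))"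
      by blast+
    define s where "s Y = inv_into (elts (fib F Y)) (act \<tau> Y)" for Y
    have s: "s Y b \<in> elts (fib F Y)" "act \<tau> Y (s Y b) = b"
      if "Y \<in> elts (Ob C)" "b \<in> elts (fib G Y)" for Y b
      using bij[OF that(1)] that(2) unfolding s_def bij_betw_def
      by (auto intro: inv_into_into f_inv_into_f)
    have s': "s Y (act \<tau> Y a) = a" if "Y \<in> elts (Ob C)" "a \<in> elts (fib F Y)" for Y a
      using bij[OF that(1)] that(2) unfolding s_def by (simp add: bij_betw_inv_into_left)
    define \<sigma> where "\<sigma> = lam (Ob C) (\<lambda>Y. \<langle>fib G Y, fib F Y, lam (fib G Y) (s Y)\<rangle>)"
    have maps: "ens_map N (fib G Y) (fib F Y) (lam (fib G Y) (s Y))" if Y: "Y \<in> elts (Ob C)" for Y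
      unfolding ens_map_def
      using presheaf_object(2)[OF C F Y] presheaf_object(2)[OF C G Y] s(1)[OF Y]
      by (auto intro: lam(1))
    have maps': "\<langle>fib G Y, fib F Y, lam (fib G Y) (s Y)\<rangle> \<in> elts (Mor (Ens N))"
      if Y: "Y \<in> elts (Ob C)" for Y
      using maps[OF Y] by auto
    have \<sigma>_map: "is_map \<sigma> (Ob C) (Mor (Ens N))"
      unfolding \<sigma>_def by (rule lam(1)[OF maps'])
    have \<sigma>_app: "\<sigma> \<cdot> Y = \<langle>fib G Y, fib F Y, lam (fib G Y) (s Y)\<rangle>" if "Y \<in> elts (Ob C)" for Y
      unfolding \<sigma>_def by (rule lam(2)[OF maps' that])
    have \<sigma>_act: "act \<sigma> Y b = s Y b" if Y: "Y \<in> elts (Ob C)" and b: "b \<in> elts (fib G Y)" for Y b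
    proof -
      have "lam (fib G Y) (s Y) \<cdot> b = s Y b"
        by (rule lam(2)[OF s(1)[OF Y] b])
      then show ?thesis
        unfolding act_def by (simp add: \<sigma>_app[OF Y])
    qed
    have \<sigma>: "functor_morphism (opcat C) (Ens N) G F \<sigma>"
      unfolding presheaf_morphism_iff[OF C G F]
    proof (intro conjI ballI)
      fix k b assume k: "k \<in> elts (Mor C)" and b: "b \<in> elts (fib G (Tgt C \<cdot> k))"
      let ?s = "Src C \<cdot> k" and ?t = "Tgt C \<cdot> k"
      have st: "?s \<in> elts (Ob C)" "?t \<in> elts (Ob C)"
        using Ob(4)[OF C k] by auto
      have "act \<tau> ?s (act F k (s ?t b)) = act G k (act \<tau> ?t (s ?t b))"
        using \<tau> k s(1)[OF st(2) b] unfolding presheaf_morphism_iff[OF C F G] by blast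
      then have "act \<tau> ?s (act F k (s ?t b)) = act G k b"
        using s(2)[OF st(2) b] by simp
      then have "s ?s (act G k b) = act F k (s ?t b)"
        using s'[OF st(1)] presheaf_arrow(4)[OF C F k s(1)[OF st(2) b]] by metis
      then show "act \<sigma> ?s (act G k b) = act F k (act \<sigma> ?t b)"
        using \<sigma>_act[OF st(2) b] \<sigma>_act[OF st(1)] presheaf_arrow(4)[OF C G k b] by simp
    qed (simp_all add: \<sigma>_map \<sigma>_app)
    have "composes (Ens N) (\<sigma> \<cdot> Y) (\<tau> \<cdot> Y) (F \<cdot> Y)"
        "composes (Ens N) (\<tau> \<cdot> Y) (\<sigma> \<cdot> Y) (G \<cdot> Y)" if Y: "Y \<in> elts (Ob C)" for Y
      using inverse[OF C F G \<tau> \<sigma> Y] inverse[OF C G F \<sigma> \<tau> Y] \<sigma>_act[OF Y] s[OF Y] s'[OF Y]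
        act_in[OF C F G \<tau> Y] by auto
    with \<tau> \<sigma> show "functor_isomorphism (opcat C) (Ens N) F G \<tau>"
      unfolding functor_isomorphism_def Ob_opcat[OF C] by blast
  qed
qed

text \<open>
  Naturality becomes an equation between composites in \<open>C\<close>, because \<open>yoneda C X\<close> acts by
  precomposition.
\<close>

lemma representation_iff:
  assumes C: "category C" and F: "presheaf C N F" and X: "X \<in> elts (Ob C)"
  shows "representation C N F X \<tau> \<longleftrightarrow>
    is_map \<tau> (Ob C) (Mor (Ens (set_union N (power_set (Mor C))))) \<and>
    (\<forall>Y\<in>elts (Ob C). \<tau> \<cdot> Y = \<langle>fib F Y, Hom C Y X, graph (\<tau> \<cdot> Y)\<rangle> \<and>
      bij_betw (act \<tau> Y) (elts (fib F Y)) (elts (Hom C Y X))) \<and>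
    (\<forall>k\<in>elts (Mor C). \<forall>a\<in>elts (fib F (Tgt C \<cdot> k)).
      composes C (act \<tau> (Tgt C \<cdot> k) a) k (act \<tau> (Src C \<cdot> k) (act F k a)))"
    (is "_ \<longleftrightarrow> ?map \<and> ?bij \<and> ?nat")
proof -
  let ?N = "set_union N (power_set (Mor C))"
  have F': "presheaf C ?N F" and G: "presheaf C ?N (yoneda C X)"
    by (rule presheaf_mono[OF F], simp, rule presheaf_mono[OF presheaf_yoneda[OF C]], simp)
  have "composes C (act \<tau> (Tgt C \<cdot> k) a) k b \<longleftrightarrow> b = act (yoneda C X) k (act \<tau> (Tgt C \<cdot> k) a)"
    if ?bij "k \<in> elts (Mor C)" "a \<in> elts (fib F (Tgt C \<cdot> k))" for k a b
  proof -
    have "act \<tau> (Tgt C \<cdot> k) a \<in> elts (Hom C (Tgt C \<cdot> k) X)"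
      using that Ob(4)[OF C that(2)] by (blast dest: bij_betw_apply)
    then show ?thesis
      using yoneda_act[OF C that(2), of "act \<tau> (Tgt C \<cdot> k) a" X] that(2)
      by (simp add: composes_iff[OF C])
  qed
  then show ?thesis
    unfolding representation_def presheaf_isomorphism_iff[OF C F' G] presheaf_morphism_iff[OF C F' G]
    by (auto simp: yoneda_object(2)[OF C] simp del: Hom(2))
qed

section \<open>Closure properties of superstructures\<close>

lemma level_mono: "m \<le> n \<Longrightarrow> level B m \<subseteq> level B n"
  by (induction n) (auto simp: le_Suc_eq)

text \<open>The levels of a superstructure as elements of the universe.\<close>

primrec level_set :: "'v::set_universe \<Rightarrow> nat \<Rightarrow> 'v" where
  "level_set B 0 = B"
| "level_set B (Suc n) = set_union (level_set B n) (power_set (level_set B n))"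

lemma elts_level_set [simp]: "elts (level_set B n) = level B n"
  by (induction n) auto

context
  fixes B :: "'v::set_universe"
  assumes B: "base_set B"
begin

lemma level_transitive: "x \<in> level B n \<Longrightarrow> y \<in> elts x \<Longrightarrow> y \<in> level B n"
proof (induction n)
  case 0
  then show ?case
    using B elts_urelement unfolding base_set_def by fastforce
qed auto

lemma hat_transitive: "x \<in> hat B \<Longrightarrow> y \<in> elts x \<Longrightarrow> y \<in> hat B"
  unfolding hat_def using level_transitive by blast

lemma hat_bounded:
  assumes "x \<in> hat B"
  obtains n where "x \<in> level B n" "elts x \<subseteq> level B n"
  using assms level_transitive unfolding hat_def by blast

lemma hat_setI: "is_set x \<Longrightarrow> elts x \<subseteq> level B n \<Longrightarrow> x \<in> hat B"
  unfolding hat_def by (auto intro!: exI[of _ "Suc n"])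

lemma hat_subset: "is_set x \<Longrightarrow> elts x \<subseteq> elts K \<Longrightarrow> K \<in> hat B \<Longrightarrow> x \<in> hat B"
  by (metis hat_bounded hat_setI order_trans)

lemma base_in_hat: "B \<in> hat B"
  using hat_setI[of B 0] B unfolding base_set_def by simp

lemma level_set_in_hat: "level_set B n \<in> hat B"
proof (rule hat_setI)
  show "is_set (level_set B n)"
    using B by (cases n) (auto simp: base_set_def)
qed auto

lemma is_set_hat_iff: "x \<in> hat B \<Longrightarrow> is_set x \<longleftrightarrow> x \<notin> elts B"
proof -
  have "x \<in> level B n \<Longrightarrow> x \<in> elts B \<or> is_set x" for n
    by (induction n) auto
  then show "x \<in> hat B \<Longrightarrow> is_set x \<longleftrightarrow> x \<notin> elts B"
    using B unfolding hat_def base_set_def by blast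
qed

lemma hat_doubleton: "x \<in> hat B \<Longrightarrow> y \<in> hat B \<Longrightarrow> mk_set {x, y} \<in> hat B"
proof -
  assume xy: "x \<in> hat B" "y \<in> hat B"
  obtain m where "x \<in> level B m"
    using xy(1) by (rule hat_bounded)
  moreover obtain n where "y \<in> level B n"
    using xy(2) by (rule hat_bounded)
  ultimately have "{x, y} \<subseteq> level B (max m n)"
    using level_mono[of m "max m n"] level_mono[of n "max m n"] by auto
  then show "mk_set {x, y} \<in> hat B"
    using hat_setI by simp
qed

lemma hat_opair: "x \<in> hat B \<Longrightarrow> y \<in> hat B \<Longrightarrow> \<langle>x, y\<rangle> \<in> hat B"
  using hat_doubleton[of x x] hat_doubleton by (simp add: opair_def)

lemma hat_opairD: "\<langle>x, y\<rangle> \<in> hat B \<Longrightarrow> x \<in> hat B \<and> y \<in> hat B"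
proof -
  assume "\<langle>x, y\<rangle> \<in> hat B"
  then have "mk_set {x, y} \<in> hat B"
    by (rule hat_transitive) (simp add: opair_def)
  then show "x \<in> hat B \<and> y \<in> hat B"
    using hat_transitive[of "mk_set {x, y}" x] hat_transitive[of "mk_set {x, y}" y] by simp
qed

text \<open>This includes the default value of application, the empty set.\<close>

lemma hat_app: "f \<in> hat B \<Longrightarrow> f \<cdot> x \<in> hat B"
proof (cases "\<exists>!y. \<langle>x, y\<rangle> \<in> elts f")
  case True
  assume "f \<in> hat B"
  obtain y where "\<langle>x, y\<rangle> \<in> elts f" "f \<cdot> x = y"
    using True app_eqI by blast
  then show ?thesis
    using \<open>f \<in> hat B\<close> hat_transitive hat_opairD by blast
next
  case False
  then show ?thesis
    using hat_setI[of "mk_set {}"] by (simp add: app_def)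
qed

lemma hat_power_set: "A \<in> hat B \<Longrightarrow> power_set A \<in> hat B"
proof -
  assume "A \<in> hat B"
  then obtain n where "elts A \<subseteq> level B n"
    by (rule hat_bounded)
  then have "elts (power_set A) \<subseteq> level B (Suc n)"
    by auto
  then show ?thesis
    using hat_setI power_set(1) by blast
qed

lemma hat_big_union: "A \<in> hat B \<Longrightarrow> big_union A \<in> hat B"
proof -
  assume "A \<in> hat B"
  then obtain n where "elts A \<subseteq> level B n"
    by (rule hat_bounded)
  then have "elts (big_union A) \<subseteq> level B n"
    using level_transitive by auto
  then show ?thesis
    using hat_setI big_union(1) by blast
qed

lemma hat_cart: "X \<in> hat B \<Longrightarrow> Y \<in> hat B \<Longrightarrow> cart X Y \<in> hat B"
  by (rule hat_subset[of _ "power_set (power_set (set_union X Y))"])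
    (use cart_subset[of X Y] in \<open>simp_all only: cart(1) cart(2) set_union_eq hat_power_set hat_big_union hat_doubleton\<close>)

lemma hat_Ens:
  assumes "N \<in> hat B"
  shows "Mor (Ens N) \<in> hat B" "Src (Ens N) \<in> hat B" "Tgt (Ens N) \<in> hat B" "Cmp (Ens N) \<in> hat B"
proof -
  have "cart (cart N N) (power_set (cart (big_union N) (big_union N))) \<in> hat B"
    using assms by (intro hat_cart hat_power_set hat_big_union)
  then show M: "Mor (Ens N) \<in> hat B"
    using hat_subset[OF Mor_Ens(1)] Mor_Ens_subset[of N] unfolding Mor_Ens(2) by blast
  have MM: "cart (Mor (Ens N)) (Mor (Ens N)) \<in> hat B"
    using M by (intro hat_cart)
  show "Src (Ens N) \<in> hat B"
    using hat_subset[OF Src_Ens(1) _ MM] Src_Ens_subset(1)[of N] unfolding Src_Ens(2) by blast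
  show "Tgt (Ens N) \<in> hat B"
    using hat_subset[OF Tgt_Ens(1) _ MM] Src_Ens_subset(2)[of N] unfolding Tgt_Ens(2) by blast
  show "Cmp (Ens N) \<in> hat B"
    using hat_subset[OF Cmp_Ens(1) _ hat_cart[OF MM M]] Cmp_Ens_subset[of N]
    unfolding Cmp_Ens(2) by blast
qed

lemma hat_is_map: "is_map f X Y \<Longrightarrow> X \<in> hat B \<Longrightarrow> Y \<in> hat B \<Longrightarrow> f \<in> hat B"
  using hat_transitive[OF hat_power_set[OF hat_cart]] is_mapD(5) by blast

end


section \<open>A calculus for the transfer principle\<close>

lemma val_cong: "(\<And>i. i \<in> fv_trm t \<Longrightarrow> e i = e' i) \<Longrightarrow> val e t = val e' t"
  by (induction t) auto

lemma sat_cong: "(\<And>i. i \<in> fv p \<Longrightarrow> e i = e' i) \<Longrightarrow> sat e p \<longleftrightarrow> sat e' p"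
proof (induction p arbitrary: e e')
  case (AllF i t p)
  have "val e t = val e' t"
    using AllF.prems by (intro val_cong) auto
  moreover have "sat (e(i := a)) p \<longleftrightarrow> sat (e'(i := a)) p" for a
    using AllF.prems by (intro AllF.IH) auto
  ultimately show ?case
    by simp
next
  case (EqF s t)
  have "val e s = val e' s" "val e t = val e' t"
    by (rule val_cong; use EqF in simp)+
  then show ?case
    by simp
next
  case (InF s t)
  have "val e s = val e' s" "val e t = val e' t"
    by (rule val_cong; use InF in simp)+
  then show ?case
    by simp
next
  case (AndF p q)
  have "sat e p \<longleftrightarrow> sat e' p" "sat e q \<longleftrightarrow> sat e' q"
    by (rule AndF.IH; use AndF.prems in simp)+
  then show ?case
    by simp
next
  case (NotF p)
  have "sat e p \<longleftrightarrow> sat e' p"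
    by (rule NotF.IH) (use NotF.prems in simp)
  then show ?case
    by simp
qed

lemma fv_trm_map [simp]: "fv_trm (map_trm f t) = fv_trm t"
  by (induction t) auto

lemma fv_map [simp]: "fv (map_fm f p) = fv p"
  by (induction p) auto

text \<open>The assignments of elements of \<open>hat B\<close> to the variables.\<close>

definition envs :: "'v::set_universe \<Rightarrow> (nat \<Rightarrow> 'v) set" where
  "envs B = {e. range e \<subseteq> hat B}"

text \<open>An enlargement.\<close>

locale nonstandard =
  fixes S W :: "'v::set_universe" and star :: "'v \<Rightarrow> 'v"
  assumes enlargement: "enlargement S W star"
begin

lemma base_S: "base_set S" and base_W: "base_set W" and star_S: "star S = W"
  and star_hat: "x \<in> hat S \<Longrightarrow> star x \<in> hat W"
  using enlargement unfolding enlargement_def by blast+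

lemma transfer_closed:
  assumes "formula_in S p" "fv p = {}"
  shows "sat e p \<longleftrightarrow> sat e' (map_fm star p)"
proof -
  have "true_statement q \<longleftrightarrow> sat e q" if "fv q = {}" for q and e :: "nat \<Rightarrow> 'v"
    using sat_cong[of q] that unfolding true_statement_def by auto
  then have "sat e p \<longleftrightarrow> true_statement p" "sat e' (map_fm star p) \<longleftrightarrow> true_statement (map_fm star p)"
    using assms(2) by simp_all
  then show ?thesis
    using enlargement assms unfolding enlargement_def by blast
qed

text \<open>
  \<open>trf_trm n t t'\<close>: the values \<open>t e\<close> and \<open>t' e\<close> are those of a term in the variables below \<open>n\<close> and
  of its star-image.  \<open>trf n P P'\<close>: the predicates \<open>P\<close> and \<open>P'\<close> on assignments are expressed by a
  formula in the variables below \<open>n\<close> and by its star-image.  In \<open>trf\<close> only assignments in the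
  superstructures matter, because being a set is expressible only there.  There are no bound
  variables to rename: a quantifier in a formula in the variables below \<open>n\<close> binds variable \<open>n\<close>.
\<close>

definition trf_trm :: "nat \<Rightarrow> ((nat \<Rightarrow> 'v) \<Rightarrow> 'v) \<Rightarrow> ((nat \<Rightarrow> 'v) \<Rightarrow> 'v) \<Rightarrow> bool" where
  "trf_trm n t t' \<longleftrightarrow> (\<exists>\<tau>. set_trm \<tau> \<subseteq> hat S \<and> fv_trm \<tau> \<subseteq> {..<n} \<and>
     (\<forall>e. t e = val e \<tau>) \<and> (\<forall>e. t' e = val e (map_trm star \<tau>)))"

definition trf :: "nat \<Rightarrow> ((nat \<Rightarrow> 'v) \<Rightarrow> bool) \<Rightarrow> ((nat \<Rightarrow> 'v) \<Rightarrow> bool) \<Rightarrow> bool" where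
  "trf n P P' \<longleftrightarrow> (\<exists>p. formula_in S p \<and> fv p \<subseteq> {..<n} \<and>
     (\<forall>e\<in>envs S. P e \<longleftrightarrow> sat e p) \<and> (\<forall>e\<in>envs W. P' e \<longleftrightarrow> sat e (map_fm star p)))"

lemma transfer:
  assumes "trf 0 (\<lambda>_. P) (\<lambda>_. P')"
  shows "P \<longleftrightarrow> P'"
proof -
  have "(\<lambda>_. S) \<in> envs S" "(\<lambda>_. W) \<in> envs W"
    using base_in_hat base_S base_W unfolding envs_def by auto
  then show ?thesis
    using assms transfer_closed[of _ "\<lambda>_. S" "\<lambda>_. W"] unfolding trf_def by auto
qed

lemma trf_trm_const: "c \<in> hat S \<Longrightarrow> trf_trm n (\<lambda>e. c) (\<lambda>e. star c)"
  unfolding trf_trm_def by (intro exI[of _ "Cst c"]) simp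

lemma trf_trm_var: "i < n \<Longrightarrow> trf_trm n (\<lambda>e. e i) (\<lambda>e. e i)"
  unfolding trf_trm_def by (intro exI[of _ "Var i"]) simp

lemma trf_trm_pair:
  assumes "trf_trm n s s'" "trf_trm n t t'"
  shows "trf_trm n (\<lambda>e. \<langle>s e, t e\<rangle>) (\<lambda>e. \<langle>s' e, t' e\<rangle>)"
proof -
  obtain \<sigma> \<tau> where
    "set_trm \<sigma> \<subseteq> hat S" "fv_trm \<sigma> \<subseteq> {..<n}" "\<forall>e. s e = val e \<sigma>" "\<forall>e. s' e = val e (map_trm star \<sigma>)"
    "set_trm \<tau> \<subseteq> hat S" "fv_trm \<tau> \<subseteq> {..<n}" "\<forall>e. t e = val e \<tau>" "\<forall>e. t' e = val e (map_trm star \<tau>)"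
    using assms unfolding trf_trm_def by blast
  then show ?thesis
    unfolding trf_trm_def by (intro exI[of _ "PairT \<sigma> \<tau>"]) simp
qed

lemma trf_trm_app:
  assumes "trf_trm n s s'" "trf_trm n t t'"
  shows "trf_trm n (\<lambda>e. s e \<cdot> t e) (\<lambda>e. s' e \<cdot> t' e)"
proof -
  obtain \<sigma> \<tau> where
    "set_trm \<sigma> \<subseteq> hat S" "fv_trm \<sigma> \<subseteq> {..<n}" "\<forall>e. s e = val e \<sigma>" "\<forall>e. s' e = val e (map_trm star \<sigma>)"
    "set_trm \<tau> \<subseteq> hat S" "fv_trm \<tau> \<subseteq> {..<n}" "\<forall>e. t e = val e \<tau>" "\<forall>e. t' e = val e (map_trm star \<tau>)"
    using assms unfolding trf_trm_def by blast
  then show ?thesis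
    unfolding trf_trm_def by (intro exI[of _ "AppT \<sigma> \<tau>"]) simp
qed

lemmas trf_trms = trf_trm_const trf_trm_var trf_trm_pair trf_trm_app

lemma trf_trm_mono: "trf_trm m t t' \<Longrightarrow> m \<le> n \<Longrightarrow> trf_trm n t t'"
  unfolding trf_trm_def by (meson lessThan_subset_iff order_trans)

lemma trf_trm_upd:
  assumes "trf_trm n t t'" "n \<le> i"
  shows "t (e(i := a)) = t e" "t' (e(i := a)) = t' e"
proof -
  obtain \<tau> where *: "fv_trm \<tau> \<subseteq> {..<n}" "\<And>e. t e = val e \<tau>" "\<And>e. t' e = val e (map_trm star \<tau>)"
    using assms(1) unfolding trf_trm_def by auto
  show "t (e(i := a)) = t e"
    unfolding * by (rule val_cong) (use *(1) assms(2) in auto)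
  show "t' (e(i := a)) = t' e"
    unfolding * by (rule val_cong) (use *(1) assms(2) in auto)
qed

lemma val_hat:
  "base_set B \<Longrightarrow> e \<in> envs B \<Longrightarrow> set_trm \<tau> \<subseteq> hat B \<Longrightarrow> val e \<tau> \<in> hat B"
  by (induction \<tau>) (auto simp: envs_def hat_opair hat_app)

lemma trf_trm_hat:
  assumes "trf_trm n t t'"
  shows "e \<in> envs S \<Longrightarrow> t e \<in> hat S" "e \<in> envs W \<Longrightarrow> t' e \<in> hat W"
proof -
  obtain \<tau> where *: "set_trm \<tau> \<subseteq> hat S" "\<And>e. t e = val e \<tau>" "\<And>e. t' e = val e (map_trm star \<tau>)"
    using assms(1) unfolding trf_trm_def by auto
  show "e \<in> envs S \<Longrightarrow> t e \<in> hat S"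
    unfolding * using val_hat[OF base_S _ *(1)] .
  show "e \<in> envs W \<Longrightarrow> t' e \<in> hat W"
    unfolding * by (rule val_hat[OF base_W]) (use *(1) star_hat in \<open>auto simp: trm.set_map\<close>)
qed

lemma trf_eq:
  assumes "trf_trm n s s'" "trf_trm n t t'"
  shows "trf n (\<lambda>e. s e = t e) (\<lambda>e. s' e = t' e)"
proof -
  obtain \<sigma> \<tau> where
    "set_trm \<sigma> \<subseteq> hat S" "fv_trm \<sigma> \<subseteq> {..<n}" "\<forall>e. s e = val e \<sigma>" "\<forall>e. s' e = val e (map_trm star \<sigma>)"
    "set_trm \<tau> \<subseteq> hat S" "fv_trm \<tau> \<subseteq> {..<n}" "\<forall>e. t e = val e \<tau>" "\<forall>e. t' e = val e (map_trm star \<tau>)"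
    using assms unfolding trf_trm_def by blast
  then show ?thesis
    unfolding trf_def by (intro exI[of _ "EqF \<sigma> \<tau>"]) (simp add: formula_in_def)
qed

lemma trf_in:
  assumes "trf_trm n s s'" "trf_trm n t t'"
  shows "trf n (\<lambda>e. s e \<in> elts (t e)) (\<lambda>e. s' e \<in> elts (t' e))"
proof -
  obtain \<sigma> \<tau> where
    "set_trm \<sigma> \<subseteq> hat S" "fv_trm \<sigma> \<subseteq> {..<n}" "\<forall>e. s e = val e \<sigma>" "\<forall>e. s' e = val e (map_trm star \<sigma>)"
    "set_trm \<tau> \<subseteq> hat S" "fv_trm \<tau> \<subseteq> {..<n}" "\<forall>e. t e = val e \<tau>" "\<forall>e. t' e = val e (map_trm star \<tau>)"
    using assms unfolding trf_trm_def by blast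
  then show ?thesis
    unfolding trf_def by (intro exI[of _ "InF \<sigma> \<tau>"]) (simp add: formula_in_def)
qed

lemma trf_not:
  assumes "trf n P P'"
  shows "trf n (\<lambda>e. \<not> P e) (\<lambda>e. \<not> P' e)"
proof -
  obtain p where "formula_in S p" "fv p \<subseteq> {..<n}"
    "\<forall>e\<in>envs S. P e \<longleftrightarrow> sat e p" "\<forall>e\<in>envs W. P' e \<longleftrightarrow> sat e (map_fm star p)"
    using assms unfolding trf_def by blast
  then show ?thesis
    unfolding trf_def by (intro exI[of _ "NotF p"]) (simp add: formula_in_def)
qed

lemma trf_and:
  assumes "trf n P P'" "trf n Q Q'"
  shows "trf n (\<lambda>e. P e \<and> Q e) (\<lambda>e. P' e \<and> Q' e)"
proof -
  obtain p q where "formula_in S p" "fv p \<subseteq> {..<n}"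
    "\<forall>e\<in>envs S. P e \<longleftrightarrow> sat e p" "\<forall>e\<in>envs W. P' e \<longleftrightarrow> sat e (map_fm star p)"
    "formula_in S q" "fv q \<subseteq> {..<n}"
    "\<forall>e\<in>envs S. Q e \<longleftrightarrow> sat e q" "\<forall>e\<in>envs W. Q' e \<longleftrightarrow> sat e (map_fm star q)"
    using assms unfolding trf_def by blast
  then show ?thesis
    unfolding trf_def by (intro exI[of _ "AndF p q"]) (simp add: formula_in_def)
qed

lemma trf_imp:
  assumes "trf n P P'" "trf n Q Q'"
  shows "trf n (\<lambda>e. P e \<longrightarrow> Q e) (\<lambda>e. P' e \<longrightarrow> Q' e)"
  using trf_not[OF trf_and[OF assms(1) trf_not[OF assms(2)]]] by simp

lemma trf_iff:
  assumes "trf n P P'" "trf n Q Q'"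
  shows "trf n (\<lambda>e. P e \<longleftrightarrow> Q e) (\<lambda>e. P' e \<longleftrightarrow> Q' e)"
  using trf_and[OF trf_imp[OF assms] trf_imp[OF assms(2,1)]] by (simp add: iff_conv_conj_imp)

text \<open>
  The last two hypotheses say that \<open>P\<close> and \<open>P'\<close> depend on the bound variable \<open>n\<close> only through their
  last argument.
\<close>

lemma trf_all:
  assumes "trf_trm n t t'" "trf (Suc n) (\<lambda>e. P e (e n)) (\<lambda>e. P' e (e n))"
    and upd: "\<And>e a b. P (e(n := a)) b \<longleftrightarrow> P e b" "\<And>e a b. P' (e(n := a)) b \<longleftrightarrow> P' e b"
  shows "trf n (\<lambda>e. \<forall>a\<in>elts (t e). P e a) (\<lambda>e. \<forall>a\<in>elts (t' e). P' e a)"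
proof -
  obtain \<tau> where \<tau>: "set_trm \<tau> \<subseteq> hat S" "fv_trm \<tau> \<subseteq> {..<n}"
    "\<And>e. t e = val e \<tau>" "\<And>e. t' e = val e (map_trm star \<tau>)"
    using assms(1) unfolding trf_trm_def by blast
  obtain p where p: "formula_in S p" "fv p \<subseteq> {..<Suc n}"
    "\<And>e. e \<in> envs S \<Longrightarrow> P e (e n) \<longleftrightarrow> sat e p"
    "\<And>e. e \<in> envs W \<Longrightarrow> P' e (e n) \<longleftrightarrow> sat e (map_fm star p)"
    using assms(2) unfolding trf_def by blast
  have env: "e(n := a) \<in> envs B" if "e \<in> envs B" "x \<in> hat B" "a \<in> elts x" "base_set B" for e x a B
    using that(1) hat_transitive[OF that(4,2,3)] unfolding envs_def by auto
  have "sat (e(n := a)) p \<longleftrightarrow> P e a" if "e \<in> envs S" "a \<in> elts (t e)" for e a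
    using p(3)[OF env[OF that(1) trf_trm_hat(1)[OF assms(1) that(1)] that(2) base_S]] upd(1) by simp
  moreover have "sat (e(n := a)) (map_fm star p) \<longleftrightarrow> P' e a" if "e \<in> envs W" "a \<in> elts (t' e)" for e a
    using p(4)[OF env[OF that(1) trf_trm_hat(2)[OF assms(1) that(1)] that(2) base_W]] upd(2) by simp
  moreover have "fv p - {n} \<subseteq> {..<n}"
    using p(2) by (auto simp: less_Suc_eq)
  ultimately show ?thesis
    unfolding trf_def using p(1) \<tau>
    by (intro exI[of _ "AllF n \<tau> p"]) (simp add: formula_in_def)
qed

lemma trf_ex:
  assumes "trf_trm n t t'" "trf (Suc n) (\<lambda>e. P e (e n)) (\<lambda>e. P' e (e n))"
    and "\<And>e a b. P (e(n := a)) b \<longleftrightarrow> P e b" "\<And>e a b. P' (e(n := a)) b \<longleftrightarrow> P' e b"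
  shows "trf n (\<lambda>e. \<exists>a\<in>elts (t e). P e a) (\<lambda>e. \<exists>a\<in>elts (t' e). P' e a)"
  using trf_not[OF trf_all[of n t t' "\<lambda>e a. \<not> P e a" "\<lambda>e a. \<not> P' e a"]] trf_not assms by simp

text \<open>\<open>is_set x\<close> is expressed by \<open>x \<notin> S\<close>.\<close>

lemma trf_is_set:
  assumes "trf_trm n t t'"
  shows "trf n (\<lambda>e. is_set (t e)) (\<lambda>e. is_set (t' e))"
proof -
  have "trf n (\<lambda>e. t e \<notin> elts S) (\<lambda>e. t' e \<notin> elts (star S))"
    by (rule trf_not trf_in assms trf_trm_const base_in_hat base_S)+
  then show ?thesis
    using is_set_hat_iff[OF base_S trf_trm_hat(1)[OF assms]]
      is_set_hat_iff[OF base_W trf_trm_hat(2)[OF assms]]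
    unfolding trf_def star_S by auto
qed

lemmas trf_rules = trf_is_set trf_eq trf_in trf_not trf_and trf_imp trf_iff trf_all trf_ex

end

section \<open>Bounded forms of the basic notions\<close>

text \<open>Each notion is shown to be equivalent to a condition whose quantifiers all range
  over the elements of the sets involved.\<close>

lemma is_map_bounded:
  "is_map f A B \<longleftrightarrow> is_set f \<and>
    (\<forall>z\<in>elts f. \<exists>x\<in>elts A. \<exists>y\<in>elts B. z = \<langle>x, y\<rangle>) \<and>
    (\<forall>x\<in>elts A. \<exists>y\<in>elts B. \<langle>x, y\<rangle> \<in> elts f \<and> (\<forall>y'\<in>elts B. \<langle>x, y'\<rangle> \<in> elts f \<longrightarrow> y' = y))"
  (is "_ \<longleftrightarrow> is_set f \<and> ?sub \<and> ?fun")
proof -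
  have "elts f \<subseteq> {\<langle>x, y\<rangle> | x y. x \<in> elts A \<and> y \<in> elts B} \<longleftrightarrow> ?sub"
    by blast
  moreover have "(\<forall>x\<in>elts A. \<exists>!y. \<langle>x, y\<rangle> \<in> elts f) \<longleftrightarrow> ?fun" if ?sub
  proof -
    have "y \<in> elts B" if "\<langle>x, y\<rangle> \<in> elts f" for x y
      using \<open>?sub\<close> that by fastforce
    then show ?thesis
      by (intro ball_cong refl) blast
  qed
  ultimately show ?thesis
    unfolding is_map_def by blast
qed

lemma eq_Hom_bounded:
  "H = Hom C X Y \<longleftrightarrow> is_set H \<and>
    (\<forall>f\<in>elts H. f \<in> elts (Mor C) \<and> Src C \<cdot> f = X \<and> Tgt C \<cdot> f = Y) \<and>
    (\<forall>f\<in>elts (Mor C). Src C \<cdot> f = X \<and> Tgt C \<cdot> f = Y \<longrightarrow> f \<in> elts H)"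
proof -
  have "H = Hom C X Y \<longleftrightarrow> is_set H \<and> elts H = elts (Hom C X Y)"
    using extensionality Hom(1) by blast
  then show ?thesis
    by auto
qed

lemma eq_id_graph_bounded:
  "i = lam A (\<lambda>x. x) \<longleftrightarrow> is_set i \<and>
    (\<forall>z\<in>elts i. \<exists>x\<in>elts A. z = \<langle>x, x\<rangle>) \<and> (\<forall>x\<in>elts A. \<langle>x, x\<rangle> \<in> elts i)"
proof -
  note id = lam[of A "\<lambda>x. x" A]
  have "i = lam A (\<lambda>x. x) \<longleftrightarrow> is_set i \<and> elts i = elts (lam A (\<lambda>x. x))"
    using extensionality is_mapD(1)[OF id(1)] by blast
  moreover have "elts (lam A (\<lambda>x. x)) = {\<langle>x, x\<rangle> | x. x \<in> elts A}"
    by (rule lam(3))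
  ultimately show ?thesis
    by auto
qed

lemma contravariant_functor_bounded:
  assumes "category C"
  shows "is_functor (opcat C) D F \<longleftrightarrow>
    is_map F (Mor C) (Mor D) \<and>
    (\<forall>f\<in>elts (Mor C). F \<cdot> (Tgt C \<cdot> f) = Src D \<cdot> (F \<cdot> f) \<and> F \<cdot> (Src C \<cdot> f) = Tgt D \<cdot> (F \<cdot> f)) \<and>
    (\<forall>f\<in>elts (Mor C). \<forall>g\<in>elts (Mor C). \<forall>h\<in>elts (Mor C).
      composes C f g h \<longrightarrow> composes D (F \<cdot> g) (F \<cdot> f) (F \<cdot> h))"
  unfolding contravariant_functor_iff[OF assms] using composes_in_Mor[OF assms] by meson

lemma category_bounded:
  "category C \<longleftrightarrow>
     is_set (Mor C) \<and> is_map (Src C) (Mor C) (Mor C) \<and> is_map (Tgt C) (Mor C) (Mor C) \<and>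
     is_set (Cmp C) \<and>
     (\<forall>z\<in>elts (Cmp C). \<exists>f\<in>elts (Mor C). \<exists>g\<in>elts (Mor C). \<exists>h\<in>elts (Mor C). z = \<langle>f, g, h\<rangle>) \<and>
     (\<forall>f\<in>elts (Mor C).
        Src C \<cdot> (Src C \<cdot> f) = Src C \<cdot> f \<and> Tgt C \<cdot> (Src C \<cdot> f) = Src C \<cdot> f \<and>
        Src C \<cdot> (Tgt C \<cdot> f) = Tgt C \<cdot> f \<and> Tgt C \<cdot> (Tgt C \<cdot> f) = Tgt C \<cdot> f) \<and>
     (\<forall>f\<in>elts (Mor C). \<forall>g\<in>elts (Mor C).
        (\<exists>h\<in>elts (Mor C). composes C f g h) \<longleftrightarrow> Src C \<cdot> f = Tgt C \<cdot> g) \<and>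
     (\<forall>f\<in>elts (Mor C). \<forall>g\<in>elts (Mor C). \<forall>h\<in>elts (Mor C). \<forall>h'\<in>elts (Mor C).
        composes C f g h \<and> composes C f g h' \<longrightarrow> h = h') \<and>
     (\<forall>f\<in>elts (Mor C). \<forall>g\<in>elts (Mor C). \<forall>h\<in>elts (Mor C).
        composes C f g h \<longrightarrow> Src C \<cdot> h = Src C \<cdot> g \<and> Tgt C \<cdot> h = Tgt C \<cdot> f) \<and>
     (\<forall>f\<in>elts (Mor C). composes C f (Src C \<cdot> f) f \<and> composes C (Tgt C \<cdot> f) f f) \<and>
     (\<forall>f\<in>elts (Mor C). \<forall>g\<in>elts (Mor C). \<forall>h\<in>elts (Mor C).
        \<forall>a\<in>elts (Mor C). \<forall>b\<in>elts (Mor C). \<forall>d\<in>elts (Mor C).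
        composes C f g a \<and> composes C g h b \<and> composes C a h d \<longrightarrow> composes C f b d)"
proof -
  have sub: "elts (Cmp C) \<subseteq>
        {\<langle>f, g, h\<rangle> | f g h. f \<in> elts (Mor C) \<and> g \<in> elts (Mor C) \<and> h \<in> elts (Mor C)} \<longleftrightarrow>
      (\<forall>z\<in>elts (Cmp C). \<exists>f\<in>elts (Mor C). \<exists>g\<in>elts (Mor C). \<exists>h\<in>elts (Mor C). z = \<langle>f, g, h\<rangle>)"
    by blast
  show ?thesis
  proof (cases "\<forall>z\<in>elts (Cmp C). \<exists>f\<in>elts (Mor C). \<exists>g\<in>elts (Mor C). \<exists>h\<in>elts (Mor C). z = \<langle>f, g, h\<rangle>")
    case True
    then have in_Mor: "f \<in> elts (Mor C) \<and> g \<in> elts (Mor C) \<and> h \<in> elts (Mor C)"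
      if "composes C f g h" for f g h
      using that unfolding composes_def by fastforce
    have 1: "(\<forall>f\<in>elts (Mor C). \<forall>g\<in>elts (Mor C).
          (\<exists>h\<in>elts (Mor C). composes C f g h) \<longleftrightarrow> Src C \<cdot> f = Tgt C \<cdot> g) \<longleftrightarrow>
        (\<forall>f\<in>elts (Mor C). \<forall>g\<in>elts (Mor C).
          (\<exists>h. composes C f g h) \<longleftrightarrow> Src C \<cdot> f = Tgt C \<cdot> g)"
      by (intro ball_cong refl) (use in_Mor in blast)
    have 2: "(\<forall>f\<in>elts (Mor C). \<forall>g\<in>elts (Mor C). \<forall>h\<in>elts (Mor C). \<forall>h'\<in>elts (Mor C).
          composes C f g h \<and> composes C f g h' \<longrightarrow> h = h') \<longleftrightarrow>
        (\<forall>f g h h'. composes C f g h \<and> composes C f g h' \<longrightarrow> h = h')"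
      using in_Mor by blast
    have 3: "(\<forall>f\<in>elts (Mor C). \<forall>g\<in>elts (Mor C). \<forall>h\<in>elts (Mor C).
          composes C f g h \<longrightarrow> Src C \<cdot> h = Src C \<cdot> g \<and> Tgt C \<cdot> h = Tgt C \<cdot> f) \<longleftrightarrow>
        (\<forall>f g h. composes C f g h \<longrightarrow> Src C \<cdot> h = Src C \<cdot> g \<and> Tgt C \<cdot> h = Tgt C \<cdot> f)"
      using in_Mor by blast
    have 4: "(\<forall>f\<in>elts (Mor C). \<forall>g\<in>elts (Mor C). \<forall>h\<in>elts (Mor C).
          \<forall>a\<in>elts (Mor C). \<forall>b\<in>elts (Mor C). \<forall>d\<in>elts (Mor C).
          composes C f g a \<and> composes C g h b \<and> composes C a h d \<longrightarrow> composes C f b d) \<longleftrightarrow>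
        (\<forall>f g h a b d. composes C f g a \<and> composes C g h b \<and> composes C a h d \<longrightarrow> composes C f b d)"
      using in_Mor by blast
    show ?thesis
      unfolding category_def sub 1 2 3 4 by (rule refl)
  next
    case False
    then show ?thesis
      unfolding category_def sub by (simp only: simp_thms)
  qed
qed


section \<open>Transfer of categories and presheaves\<close>

context nonstandard
begin

lemma trf_is_map:
  assumes f: "trf_trm n f f'" and A: "trf_trm n A A'" and B: "trf_trm n B B'"
  shows "trf n (\<lambda>e. is_map (f e) (A e) (B e)) (\<lambda>e. is_map (f' e) (A' e) (B' e))"
proof -
  note mono = f[THEN trf_trm_mono] A[THEN trf_trm_mono] B[THEN trf_trm_mono]
  note upd = trf_trm_upd[OF f] trf_trm_upd[OF A] trf_trm_upd[OF B]
  show ?thesis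
    unfolding is_map_bounded
    by (rule trf_rules trf_trm_pair trf_trm_var mono | (simp add: upd; fail))+
qed

lemma trf_composes:
  assumes "Cmp C \<in> hat S" "trf_trm n f f'" "trf_trm n g g'" "trf_trm n h h'"
  shows "trf n (\<lambda>e. composes C (f e) (g e) (h e)) (\<lambda>e. composes (star_cat star C) (f' e) (g' e) (h' e))"
  unfolding composes_def cat.map_sel by (rule assms trf_in trf_trms)+

lemma trf_eq_Hom:
  assumes C: "Mor C \<in> hat S" "Src C \<in> hat S" "Tgt C \<in> hat S"
    and H: "trf_trm n H H'" and X: "trf_trm n X X'" and Y: "trf_trm n Y Y'"
  shows "trf n (\<lambda>e. H e = Hom C (X e) (Y e)) (\<lambda>e. H' e = Hom (star_cat star C) (X' e) (Y' e))"
proof -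
  note mono = H[THEN trf_trm_mono] X[THEN trf_trm_mono] Y[THEN trf_trm_mono]
  note upd = trf_trm_upd[OF H] trf_trm_upd[OF X] trf_trm_upd[OF Y]
  show ?thesis
    unfolding eq_Hom_bounded cat.map_sel
    by (rule C trf_rules trf_trms mono | (simp add: upd; fail))+
qed

lemma trf_eq_id_graph:
  assumes i: "trf_trm n i i'" and A: "trf_trm n A A'"
  shows "trf n (\<lambda>e. i e = lam (A e) (\<lambda>x. x)) (\<lambda>e. i' e = lam (A' e) (\<lambda>x. x))"
proof -
  note mono = i[THEN trf_trm_mono] A[THEN trf_trm_mono]
  note upd = trf_trm_upd[OF i] trf_trm_upd[OF A]
  show ?thesis
    unfolding eq_id_graph_bounded
    by (rule trf_rules trf_trm_pair trf_trm_var mono | (simp add: upd; fail))+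
qed

text \<open>
  A transferred statement is proved by resolving with these rules; the side conditions say
  that constants lie in \<open>hat S\<close>, that indices of variables are in range, and that the two sides of a
  quantified formula do not depend on the old value of the bound variable.  The rule for equations
  comes after those for defined sets, since these are not terms.
\<close>

lemmas transfers = trf_composes trf_eq_Hom trf_eq_id_graph trf_is_map trf_rules trf_trms

lemma star_mem_iff: "x \<in> hat S \<Longrightarrow> A \<in> hat S \<Longrightarrow> star x \<in> elts (star A) \<longleftrightarrow> x \<in> elts A"
  using transfer[OF trf_in[OF trf_trm_const trf_trm_const]] by blast

lemma star_subset: "A \<in> hat S \<Longrightarrow> B \<in> hat S \<Longrightarrow> elts A \<subseteq> elts B \<Longrightarrow> elts (star A) \<subseteq> elts (star B)"
proof -
  assume hat: "A \<in> hat S" "B \<in> hat S" and "elts A \<subseteq> elts B"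
  have "(\<forall>x\<in>elts A. x \<in> elts B) \<longleftrightarrow> (\<forall>x\<in>elts (star A). x \<in> elts (star B))"
    by (rule transfer, (rule hat transfers | (simp; fail))+)
  then show ?thesis
    using \<open>elts A \<subseteq> elts B\<close> by blast
qed

end

text \<open>An enlargement together with a small category \<open>C\<close>; \<open>D\<close> is the enlarged category.\<close>

locale nonstandard_category = nonstandard S W star
  for S W :: "'v::set_universe" and star :: "'v \<Rightarrow> 'v" +
  fixes C :: "'v::set_universe cat"
  assumes small: "small_category S C"
begin

abbreviation D where "D \<equiv> star_cat star C"

lemma C: "category C"
  using small unfolding small_category_def by blast

lemma hat_Mor: "Mor C \<in> hat S"
  using small unfolding small_category_def by blast

lemma hat_Src: "Src C \<in> hat S" and hat_Tgt: "Tgt C \<in> hat S"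
proof -
  have "is_map (Src C) (Mor C) (Mor C)" "is_map (Tgt C) (Mor C) (Mor C)"
    using C unfolding category_def by blast+
  then show "Src C \<in> hat S" "Tgt C \<in> hat S"
    using hat_Mor by (blast intro: hat_is_map[OF base_S])+
qed

lemma hat_Cmp: "Cmp C \<in> hat S"
proof (rule hat_subset[OF base_S])
  show "is_set (Cmp C)"
    using C unfolding category_def by blast
  show "elts (Cmp C) \<subseteq> elts (cart (cart (Mor C) (Mor C)) (Mor C))"
    using C unfolding category_bounded by fastforce
  show "cart (cart (Mor C) (Mor C)) (Mor C) \<in> hat S"
    using hat_Mor hat_cart[OF base_S] by blast
qed

lemma hat_Ob: "Ob C \<in> hat S"
  using hat_subset[OF base_S Ob(1)[OF C] _ hat_Mor] Ob(2)[OF C] by blast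

lemmas hat_C = hat_Mor hat_Src hat_Tgt hat_Cmp hat_Ob

lemma category_star: "category D"
proof -
  have "category C \<longleftrightarrow> category D"
    unfolding category_bounded cat.map_sel
    by (rule transfer, (rule hat_C transfers | (simp; fail))+)
  with C show ?thesis
    by blast
qed

lemma star_Ob: "Ob D = star (Ob C)"
proof (rule extensionality)
  have "is_set (Ob C) \<and> (\<forall>f\<in>elts (Ob C). f \<in> elts (Mor C)) \<and>
      (\<forall>f\<in>elts (Mor C). f \<in> elts (Ob C) \<longleftrightarrow> Src C \<cdot> f = f) \<longleftrightarrow>
    is_set (star (Ob C)) \<and> (\<forall>f\<in>elts (star (Ob C)). f \<in> elts (star (Mor C))) \<and>
      (\<forall>f\<in>elts (star (Mor C)). f \<in> elts (star (Ob C)) \<longleftrightarrow> star (Src C) \<cdot> f = f)"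
    by (rule transfer, (rule hat_C transfers | (simp; fail))+)
  then have *: "is_set (star (Ob C))" "\<forall>f\<in>elts (star (Ob C)). f \<in> elts (Mor D)"
      "\<forall>f\<in>elts (Mor D). f \<in> elts (star (Ob C)) \<longleftrightarrow> Src D \<cdot> f = f"
    using Ob(1,2)[OF C] unfolding cat.map_sel by blast+
  then show "is_set (star (Ob C))" "elts (Ob D) = elts (star (Ob C))"
    unfolding Ob(2)[OF category_star] by blast+
qed (rule Ob(1)[OF category_star])

end

section \<open>Representations inside a transitive set\<close>

text \<open>
  The condition of being a representation with all quantifiers over sets and maps restricted to \<open>L\<close>:
  \<open>\<tau>\<close> is a family of bijections from \<open>F(Y)\<close> to \<open>Mor\<^sub>C(Y, X)\<close> that is natural in \<open>Y\<close>.
\<close>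

definition representation_within ::
    "'v::set_universe \<Rightarrow> 'v cat \<Rightarrow> 'v \<Rightarrow> 'v \<Rightarrow> 'v \<Rightarrow> bool" where
  "representation_within L C F X \<tau> \<longleftrightarrow>
     is_map \<tau> (Ob C) L \<and>
     (\<forall>Y\<in>elts (Ob C). \<exists>A\<in>elts L. \<exists>H\<in>elts L. \<exists>f\<in>elts L. \<exists>i\<in>elts L.
        F \<cdot> Y = \<langle>A, A, i\<rangle> \<and> \<tau> \<cdot> Y = \<langle>A, H, f\<rangle> \<and> H = Hom C Y X \<and> is_map f A H \<and>
        (\<forall>h\<in>elts H. \<exists>a\<in>elts A. f \<cdot> a = h) \<and>
        (\<forall>a\<in>elts A. \<forall>b\<in>elts A. f \<cdot> a = f \<cdot> b \<longrightarrow> a = b)) \<and>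
     (\<forall>k\<in>elts (Mor C). \<exists>A\<in>elts L. \<exists>B\<in>elts L. \<exists>\<phi>\<in>elts L. \<exists>H\<in>elts L. \<exists>f\<in>elts L. \<exists>H'\<in>elts L. \<exists>f'\<in>elts L.
        F \<cdot> k = \<langle>A, B, \<phi>\<rangle> \<and> \<tau> \<cdot> (Tgt C \<cdot> k) = \<langle>A, H, f\<rangle> \<and> \<tau> \<cdot> (Src C \<cdot> k) = \<langle>B, H', f'\<rangle> \<and>
        (\<forall>a\<in>elts A. composes C (f \<cdot> a) k (f' \<cdot> (\<phi> \<cdot> a))))"

lemma representation_iff_within:
  assumes C: "category C" and F: "presheaf C N F" and X: "X \<in> elts (Ob C)"
    and L: "\<And>x y. x \<in> elts L \<Longrightarrow> y \<in> elts x \<Longrightarrow> y \<in> elts L"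
    and FL: "F \<in> elts L" and \<tau>L: "\<tau> \<in> elts L"
  shows "representation C N F X \<tau> \<longleftrightarrow> representation_within L C F X \<tau>"
proof -
  let ?N = "set_union N (power_set (Mor C))"
  have pair_L: "x \<in> elts L \<and> y \<in> elts L" if "\<langle>x, y\<rangle> \<in> elts L" for x y
  proof -
    have "mk_set {x, y} \<in> elts L"
      using L[OF that] by (simp add: opair_def)
    then show ?thesis
      using L[of "mk_set {x, y}"] by simp
  qed
  have "is_map F (Mor C) (Mor (Ens N))"
    using F unfolding presheaf_def is_functor_def by simp
  then have FkL: "F \<cdot> k \<in> elts L" if "k \<in> elts (Mor C)" for k
    using is_mapD(2)[OF _ that] L[OF FL] pair_L by blast
  have app_L: "\<tau> \<cdot> Y \<in> elts L" if "is_map \<tau> (Ob C) Z" "Y \<in> elts (Ob C)" for Y Z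
    using is_mapD(2)[OF that] L[OF \<tau>L] pair_L by blast
  show ?thesis
    unfolding representation_iff[OF C F X]
  proof
    assume "is_map \<tau> (Ob C) (Mor (Ens ?N)) \<and>
      (\<forall>Y\<in>elts (Ob C). \<tau> \<cdot> Y = \<langle>fib F Y, Hom C Y X, graph (\<tau> \<cdot> Y)\<rangle> \<and>
        bij_betw (act \<tau> Y) (elts (fib F Y)) (elts (Hom C Y X))) \<and>
      (\<forall>k\<in>elts (Mor C). \<forall>a\<in>elts (fib F (Tgt C \<cdot> k)).
        composes C (act \<tau> (Tgt C \<cdot> k) a) k (act \<tau> (Src C \<cdot> k) (act F k a)))"
    then have map: "is_map \<tau> (Ob C) (Mor (Ens ?N))"
      and comp: "\<And>Y. Y \<in> elts (Ob C) \<Longrightarrow> \<tau> \<cdot> Y = \<langle>fib F Y, Hom C Y X, graph (\<tau> \<cdot> Y)\<rangle>"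
      and bij: "\<And>Y. Y \<in> elts (Ob C) \<Longrightarrow> bij_betw (act \<tau> Y) (elts (fib F Y)) (elts (Hom C Y X))"
      and nat: "\<And>k a. k \<in> elts (Mor C) \<Longrightarrow> a \<in> elts (fib F (Tgt C \<cdot> k)) \<Longrightarrow>
        composes C (act \<tau> (Tgt C \<cdot> k) a) k (act \<tau> (Src C \<cdot> k) (act F k a))"
      by blast+
    have comp_L: "fib F Y \<in> elts L" "Hom C Y X \<in> elts L" "graph (\<tau> \<cdot> Y) \<in> elts L"
      if "Y \<in> elts (Ob C)" for Y
    proof -
      have "\<langle>fib F Y, Hom C Y X, graph (\<tau> \<cdot> Y)\<rangle> \<in> elts L"
        using app_L[OF map that] comp[OF that] by simp
      then show "fib F Y \<in> elts L" "Hom C Y X \<in> elts L" "graph (\<tau> \<cdot> Y) \<in> elts L"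
        using pair_L by blast+
    qed
    show "representation_within L C F X \<tau>"
      unfolding representation_within_def
    proof (intro conjI ballI)
      show "is_map \<tau> (Ob C) L"
        by (rule is_map_cod[OF map app_L[OF map]])
    next
      fix Y assume Y: "Y \<in> elts (Ob C)"
      then have "F \<cdot> Y \<in> elts L"
        using FkL Ob(3)[OF C] by blast
      then have "lam (fib F Y) (\<lambda>x. x) \<in> elts L"
        unfolding presheaf_object(1)[OF C F Y] id_map_lam using pair_L by blast
      moreover have "F \<cdot> Y = \<langle>fib F Y, fib F Y, lam (fib F Y) (\<lambda>x. x)\<rangle>"
        unfolding presheaf_object(1)[OF C F Y] id_map_lam ..
      moreover have "is_map (graph (\<tau> \<cdot> Y)) (fib F Y) (Hom C Y X)"
      proof -
        have "\<langle>fib F Y, Hom C Y X, graph (\<tau> \<cdot> Y)\<rangle> \<in> elts (Mor (Ens ?N))"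
          using is_mapD(3)[OF map Y] comp[OF Y] by simp
        then show ?thesis
          by (simp add: ens_map_def del: Hom(2))
      qed
      moreover have "\<forall>h\<in>elts (Hom C Y X). \<exists>a\<in>elts (fib F Y). graph (\<tau> \<cdot> Y) \<cdot> a = h"
        using bij_betw_imp_surj_on[OF bij[OF Y], symmetric]
        unfolding act_def by (auto simp del: Hom(2))
      moreover have "\<forall>a\<in>elts (fib F Y). \<forall>b\<in>elts (fib F Y). graph (\<tau> \<cdot> Y) \<cdot> a = graph (\<tau> \<cdot> Y) \<cdot> b \<longrightarrow> a = b"
        using bij[OF Y] unfolding bij_betw_def act_def inj_on_def by blast
      ultimately show "\<exists>A\<in>elts L. \<exists>H\<in>elts L. \<exists>f\<in>elts L. \<exists>i\<in>elts L.
        F \<cdot> Y = \<langle>A, A, i\<rangle> \<and> \<tau> \<cdot> Y = \<langle>A, H, f\<rangle> \<and> H = Hom C Y X \<and> is_map f A H \<and>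
        (\<forall>h\<in>elts H. \<exists>a\<in>elts A. f \<cdot> a = h) \<and>
        (\<forall>a\<in>elts A. \<forall>b\<in>elts A. f \<cdot> a = f \<cdot> b \<longrightarrow> a = b)"
        using comp_L[OF Y] comp[OF Y] by blast
    next
      fix k assume k: "k \<in> elts (Mor C)"
      let ?s = "Src C \<cdot> k" and ?t = "Tgt C \<cdot> k"
      have st: "?s \<in> elts (Ob C)" "?t \<in> elts (Ob C)"
        using Ob(4)[OF C k] by auto
      have "\<langle>fib F ?t, fib F ?s, graph (F \<cdot> k)\<rangle> \<in> elts L"
        using FkL[OF k] presheaf_arrow(1)[OF C F k] by simp
      then have "graph (F \<cdot> k) \<in> elts L"
        using pair_L by blast
      moreover have "\<forall>a\<in>elts (fib F ?t).
          composes C (graph (\<tau> \<cdot> ?t) \<cdot> a) k (graph (\<tau> \<cdot> ?s) \<cdot> (graph (F \<cdot> k) \<cdot> a))"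
        using nat[OF k] unfolding act_def by blast
      ultimately show "\<exists>A\<in>elts L. \<exists>B\<in>elts L. \<exists>\<phi>\<in>elts L. \<exists>H\<in>elts L. \<exists>f\<in>elts L. \<exists>H'\<in>elts L. \<exists>f'\<in>elts L.
        F \<cdot> k = \<langle>A, B, \<phi>\<rangle> \<and> \<tau> \<cdot> ?t = \<langle>A, H, f\<rangle> \<and> \<tau> \<cdot> ?s = \<langle>B, H', f'\<rangle> \<and>
        (\<forall>a\<in>elts A. composes C (f \<cdot> a) k (f' \<cdot> (\<phi> \<cdot> a)))"
        using comp_L[OF st(1)] comp_L[OF st(2)] comp[OF st(1)] comp[OF st(2)]
          presheaf_arrow(1)[OF C F k] by blast
    qed
  next
    assume within: "representation_within L C F X \<tau>"
    then have map: "is_map \<tau> (Ob C) L"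
      unfolding representation_within_def by blast
    have comp: "\<exists>f. \<tau> \<cdot> Y = \<langle>fib F Y, Hom C Y X, f\<rangle> \<and> is_map f (fib F Y) (Hom C Y X) \<and>
        bij_betw (\<lambda>a. f \<cdot> a) (elts (fib F Y)) (elts (Hom C Y X))"
      if Y: "Y \<in> elts (Ob C)" for Y
    proof -
      obtain A H f i where "H = Hom C Y X"
        and "F \<cdot> Y = \<langle>A, A, i\<rangle>" "\<tau> \<cdot> Y = \<langle>A, H, f\<rangle>" "is_map f A H"
        "\<forall>h\<in>elts H. \<exists>a\<in>elts A. f \<cdot> a = h"
        "\<forall>a\<in>elts A. \<forall>b\<in>elts A. f \<cdot> a = f \<cdot> b \<longrightarrow> a = b"
        using within[unfolded representation_within_def, THEN conjunct2, THEN conjunct1, rule_format, OF Y]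
        by (elim bexE conjE)
      note f = this(2-)[unfolded this(1)]
      have "fib F Y = A"
        using f(1) by (simp add: fib_def)
      moreover have "bij_betw (\<lambda>a. f \<cdot> a) (elts A) (elts (Hom C Y X))"
        by (rule bij_betw_imageI) (use f(4,5) is_mapD(3)[OF f(3)] in \<open>auto simp: inj_on_def simp del: Hom(2)\<close>)
      ultimately show ?thesis
        using f by blast
    qed
    have comp': "\<tau> \<cdot> Y = \<langle>fib F Y, Hom C Y X, graph (\<tau> \<cdot> Y)\<rangle>"
        "is_map (graph (\<tau> \<cdot> Y)) (fib F Y) (Hom C Y X)"
        "bij_betw (act \<tau> Y) (elts (fib F Y)) (elts (Hom C Y X))" if Y: "Y \<in> elts (Ob C)" for Y
    proof -
      obtain f where f: "\<tau> \<cdot> Y = \<langle>fib F Y, Hom C Y X, f\<rangle>" "is_map f (fib F Y) (Hom C Y X)"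
        "bij_betw (\<lambda>a. f \<cdot> a) (elts (fib F Y)) (elts (Hom C Y X))"
        using comp[OF Y] by blast
      moreover from f(1) have "graph (\<tau> \<cdot> Y) = f"
        by simp
      moreover from this have "act \<tau> Y = (\<lambda>a. f \<cdot> a)"
        by (simp add: act_def fun_eq_iff)
      ultimately show "\<tau> \<cdot> Y = \<langle>fib F Y, Hom C Y X, graph (\<tau> \<cdot> Y)\<rangle>"
        "is_map (graph (\<tau> \<cdot> Y)) (fib F Y) (Hom C Y X)"
        "bij_betw (act \<tau> Y) (elts (fib F Y)) (elts (Hom C Y X))"
        by simp_all
    qed
    have "is_map \<tau> (Ob C) (Mor (Ens ?N))"
    proof (rule is_map_cod[OF map])
      fix Y assume Y: "Y \<in> elts (Ob C)"
      have "ens_map ?N (fib F Y) (Hom C Y X) (graph (\<tau> \<cdot> Y))"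
        using presheaf_object(2)[OF C F Y] comp'(2)[OF Y] unfolding ens_map_def by auto
      then show "\<tau> \<cdot> Y \<in> elts (Mor (Ens ?N))"
        using comp'(1)[OF Y] unfolding Mor_Ens(2) by blast
    qed
    moreover have "composes C (act \<tau> (Tgt C \<cdot> k) a) k (act \<tau> (Src C \<cdot> k) (act F k a))"
      if k: "k \<in> elts (Mor C)" and a: "a \<in> elts (fib F (Tgt C \<cdot> k))" for k a
    proof -
      obtain A B \<phi> H f H' f' where *: "F \<cdot> k = \<langle>A, B, \<phi>\<rangle>"
        "\<tau> \<cdot> (Tgt C \<cdot> k) = \<langle>A, H, f\<rangle>" "\<tau> \<cdot> (Src C \<cdot> k) = \<langle>B, H', f'\<rangle>"
        "\<forall>a\<in>elts A. composes C (f \<cdot> a) k (f' \<cdot> (\<phi> \<cdot> a))"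
        using within[unfolded representation_within_def, THEN conjunct2, THEN conjunct2, rule_format, OF k]
        by (elim bexE conjE)
      have "fib F (Tgt C \<cdot> k) = A"
        using presheaf_arrow(1)[OF C F k] *(1) by simp
      then show ?thesis
        using * a by (simp add: act_def)
    qed
    ultimately show "is_map \<tau> (Ob C) (Mor (Ens ?N)) \<and>
      (\<forall>Y\<in>elts (Ob C). \<tau> \<cdot> Y = \<langle>fib F Y, Hom C Y X, graph (\<tau> \<cdot> Y)\<rangle> \<and>
        bij_betw (act \<tau> Y) (elts (fib F Y)) (elts (Hom C Y X))) \<and>
      (\<forall>k\<in>elts (Mor C). \<forall>a\<in>elts (fib F (Tgt C \<cdot> k)).
        composes C (act \<tau> (Tgt C \<cdot> k) a) k (act \<tau> (Src C \<cdot> k) (act F k a)))"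
      using comp' by blast
  qed
qed

lemma eq_precompose_bounded:
  assumes C: "category C" and k: "k \<in> elts (Mor C)"
  shows "\<phi> = lam (Hom C (Tgt C \<cdot> k) X) (\<lambda>g. comp_of C g k) \<longleftrightarrow> is_set \<phi> \<and>
    (\<forall>p\<in>elts \<phi>. \<exists>g\<in>elts (Hom C (Tgt C \<cdot> k) X). \<exists>h\<in>elts (Mor C). p = \<langle>g, h\<rangle> \<and> composes C g k h) \<and>
    (\<forall>g\<in>elts (Hom C (Tgt C \<cdot> k) X). \<forall>h\<in>elts (Mor C). composes C g k h \<longrightarrow> \<langle>g, h\<rangle> \<in> elts \<phi>)"
proof -
  let ?lam = "lam (Hom C (Tgt C \<cdot> k) X) (\<lambda>g. comp_of C g k)"
  have map: "is_map ?lam (Hom C (Tgt C \<cdot> k) X) (Hom C (Src C \<cdot> k) X)"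
    using ens_map_precompose(1)[OF C k] unfolding ens_map_def by blast
  have "elts ?lam = {\<langle>g, h\<rangle> | g h. g \<in> elts (Hom C (Tgt C \<cdot> k) X) \<and> h \<in> elts (Mor C) \<and> composes C g k h}"
    unfolding is_map_elts[OF map]
    using ens_map_precompose(2)[OF C k] comp_of(1)[OF C _ k] k by (auto simp: composes_iff[OF C])
  moreover have "\<phi> = ?lam \<longleftrightarrow> is_set \<phi> \<and> elts \<phi> = elts ?lam"
    using extensionality is_mapD(1)[OF map] by blast
  ultimately show ?thesis
    by (auto simp del: Hom(2))
qed

section \<open>The enlargement of the Yoneda presheaf\<close>

context nonstandard_category
begin

text \<open>
  The transferred statement lists the elements of the graph: each is a pair of a morphism \<open>k\<close> and the
  map of precomposition with \<open>k\<close>, and each \<open>k\<close> occurs.  The sets \<open>?P\<close>, \<open>?K\<close> and \<open>Mor (Ens ?P)\<close>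
  only serve as bounds for quantifiers; no information about their star-images is needed.
\<close>

lemma star_yoneda:
  assumes X: "X \<in> elts (Ob C)"
  shows "star (yoneda C X) = yoneda D (star X)"
proof -
  let ?K = "power_set (cart (Mor C) (Mor C))"
  let ?P = "power_set (Mor C)"
  have "cart (Mor C) (Mor (Ens ?P)) \<in> hat S"
    using hat_Mor by (intro hat_cart hat_Ens hat_power_set base_S)
  then have "yoneda C X \<in> hat S"
    using hat_transitive[OF base_S hat_power_set[OF base_S]] is_mapD(5)[OF yoneda_map(1)[OF C]] by blast
  moreover have "?K \<in> hat S" "?P \<in> hat S" "X \<in> hat S"
    using hat_Mor hat_transitive[OF base_S hat_Ob X] by (simp_all add: hat_cart hat_power_set base_S)
  moreover from this have "Mor (Ens ?P) \<in> hat S"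
    using hat_Ens[OF base_S] by blast
  moreover note hat_C
  ultimately have hat: "yoneda C X \<in> hat S" "?K \<in> hat S" "?P \<in> hat S" "X \<in> hat S"
      "Mor (Ens ?P) \<in> hat S" "Mor C \<in> hat S" "Src C \<in> hat S" "Tgt C \<in> hat S" "Cmp C \<in> hat S"
    by blast+
  have "is_set (yoneda C X) \<and>
    (\<forall>z\<in>elts (yoneda C X). \<exists>k\<in>elts (Mor C). \<exists>A\<in>elts ?P. \<exists>B\<in>elts ?P. \<exists>\<phi>\<in>elts ?K.
      z = \<langle>k, \<langle>A, B, \<phi>\<rangle>\<rangle> \<and> A = Hom C (Tgt C \<cdot> k) X \<and> B = Hom C (Src C \<cdot> k) X \<and> is_set \<phi> \<and>
      (\<forall>p\<in>elts \<phi>. \<exists>g\<in>elts A. \<exists>h\<in>elts (Mor C). p = \<langle>g, h\<rangle> \<and> composes C g k h) \<and>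
      (\<forall>g\<in>elts A. \<forall>h\<in>elts (Mor C). composes C g k h \<longrightarrow> \<langle>g, h\<rangle> \<in> elts \<phi>)) \<and>
    (\<forall>k\<in>elts (Mor C). \<exists>z\<in>elts (yoneda C X). \<exists>m\<in>elts (Mor (Ens ?P)). z = \<langle>k, m\<rangle>) \<longleftrightarrow>
   is_set (star (yoneda C X)) \<and>
    (\<forall>z\<in>elts (star (yoneda C X)). \<exists>k\<in>elts (Mor D). \<exists>A\<in>elts (star ?P). \<exists>B\<in>elts (star ?P). \<exists>\<phi>\<in>elts (star ?K).
      z = \<langle>k, \<langle>A, B, \<phi>\<rangle>\<rangle> \<and> A = Hom D (Tgt D \<cdot> k) (star X) \<and> B = Hom D (Src D \<cdot> k) (star X) \<and> is_set \<phi> \<and>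
      (\<forall>p\<in>elts \<phi>. \<exists>g\<in>elts A. \<exists>h\<in>elts (Mor D). p = \<langle>g, h\<rangle> \<and> composes D g k h) \<and>
      (\<forall>g\<in>elts A. \<forall>h\<in>elts (Mor D). composes D g k h \<longrightarrow> \<langle>g, h\<rangle> \<in> elts \<phi>)) \<and>
    (\<forall>k\<in>elts (Mor D). \<exists>z\<in>elts (star (yoneda C X)). \<exists>m\<in>elts (star (Mor (Ens ?P))). z = \<langle>k, m\<rangle>)"
    (is "?std \<longleftrightarrow> ?nonstd")
    unfolding cat.map_sel
    by (rule transfer, (rule hat transfers
      | (simp only: fun_upd_apply nat.inject nat.distinct if_False simp_thms; fail) | (simp; fail))+)
  have elts_yoneda: "elts (yoneda E Z) = {\<langle>k, yoneda E Z \<cdot> k\<rangle> | k. k \<in> elts (Mor E)}"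
    if "category E" for E :: "'v cat" and Z
    by (rule is_map_elts[OF yoneda_map(1)[OF that]])
  have ?std
  proof (intro conjI ballI)
    show "is_set (yoneda C X)"
      using yoneda_map(1)[OF C] by (rule is_mapD(1))
  next
    fix z assume "z \<in> elts (yoneda C X)"
    then obtain k where k: "k \<in> elts (Mor C)" "z = \<langle>k, yoneda C X \<cdot> k\<rangle>"
      using elts_yoneda[OF C] by blast
    let ?\<phi> = "lam (Hom C (Tgt C \<cdot> k) X) (\<lambda>g. comp_of C g k)"
    have Hom_P: "Hom C Y X \<in> elts ?P" for Y
      by auto
    have "is_map ?\<phi> (Hom C (Tgt C \<cdot> k) X) (Hom C (Src C \<cdot> k) X)"
      using ens_map_precompose(1)[OF C k(1)] unfolding ens_map_def by blast
    then have "is_map ?\<phi> (Hom C (Tgt C \<cdot> k) X) (Mor C)"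
    proof (rule is_map_cod)
      show "?\<phi> \<cdot> g \<in> elts (Mor C)" if "g \<in> elts (Hom C (Tgt C \<cdot> k) X)" for g
        using ens_map_precompose(2)[OF C k(1) that] comp_of(1)[OF C _ k(1), of g] that by simp
    qed
    then have "?\<phi> \<in> elts ?K"
      by (auto simp: is_map_def)
    then show "\<exists>k\<in>elts (Mor C). \<exists>A\<in>elts ?P. \<exists>B\<in>elts ?P. \<exists>\<phi>\<in>elts ?K.
      z = \<langle>k, \<langle>A, B, \<phi>\<rangle>\<rangle> \<and> A = Hom C (Tgt C \<cdot> k) X \<and> B = Hom C (Src C \<cdot> k) X \<and> is_set \<phi> \<and>
      (\<forall>p\<in>elts \<phi>. \<exists>g\<in>elts A. \<exists>h\<in>elts (Mor C). p = \<langle>g, h\<rangle> \<and> composes C g k h) \<and>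
      (\<forall>g\<in>elts A. \<forall>h\<in>elts (Mor C). composes C g k h \<longrightarrow> \<langle>g, h\<rangle> \<in> elts \<phi>)"
      using k(1) Hom_P eq_precompose_bounded[OF C k(1), of ?\<phi> X]
      unfolding k(2) yoneda_map(2)[OF C k(1)] by blast
  next
    fix k assume "k \<in> elts (Mor C)"
    then show "\<exists>z\<in>elts (yoneda C X). \<exists>m\<in>elts (Mor (Ens ?P)). z = \<langle>k, m\<rangle>"
      using elts_yoneda[OF C] is_mapD(3)[OF yoneda_map(1)[OF C]] by blast
  qed
  then have ?nonstd
    using \<open>?std \<longleftrightarrow> ?nonstd\<close> by blast
  then have set: "is_set (star (yoneda C X))"
    and elements: "\<And>z. z \<in> elts (star (yoneda C X)) \<Longrightarrow> \<exists>k\<in>elts (Mor D). z = \<langle>k, yoneda D (star X) \<cdot> k\<rangle>"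
    and defined: "\<And>k. k \<in> elts (Mor D) \<Longrightarrow> \<exists>m. \<langle>k, m\<rangle> \<in> elts (star (yoneda C X))"
  proof -
    assume ?nonstd
    then show "is_set (star (yoneda C X))"
      by blast
    show "\<exists>m. \<langle>k, m\<rangle> \<in> elts (star (yoneda C X))" if "k \<in> elts (Mor D)" for k
      using \<open>?nonstd\<close> that by blast
    show "\<exists>k\<in>elts (Mor D). z = \<langle>k, yoneda D (star X) \<cdot> k\<rangle>" if z: "z \<in> elts (star (yoneda C X))" for z
    proof -
      obtain k \<phi> where k: "k \<in> elts (Mor D)"
        and z: "z = \<langle>k, \<langle>Hom D (Tgt D \<cdot> k) (star X), Hom D (Src D \<cdot> k) (star X), \<phi>\<rangle>\<rangle>" and \<phi>: "is_set \<phi>"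
        "\<forall>p\<in>elts \<phi>. \<exists>g\<in>elts (Hom D (Tgt D \<cdot> k) (star X)). \<exists>h\<in>elts (Mor D). p = \<langle>g, h\<rangle> \<and> composes D g k h"
        "\<forall>g\<in>elts (Hom D (Tgt D \<cdot> k) (star X)). \<forall>h\<in>elts (Mor D). composes D g k h \<longrightarrow> \<langle>g, h\<rangle> \<in> elts \<phi>"
        using \<open>?nonstd\<close> z by blast
      have "\<phi> = lam (Hom D (Tgt D \<cdot> k) (star X)) (\<lambda>g. comp_of D g k)"
        unfolding eq_precompose_bounded[OF category_star k] using \<phi> by blast
      then show ?thesis
        using k unfolding z yoneda_map(2)[OF category_star k, symmetric] by (auto simp: yoneda_map(2)[OF category_star])
    qed
  qed
  show ?thesis
  proof (rule extensionality[OF set is_mapD(1)[OF yoneda_map(1)[OF category_star]]])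
    show "elts (star (yoneda C X)) = elts (yoneda D (star X))"
    proof
      show "elts (star (yoneda C X)) \<subseteq> elts (yoneda D (star X))"
        unfolding elts_yoneda[OF category_star] using elements by blast
      show "elts (yoneda D (star X)) \<subseteq> elts (star (yoneda C X))"
      proof
        fix z assume "z \<in> elts (yoneda D (star X))"
        then obtain k where k: "k \<in> elts (Mor D)" "z = \<langle>k, yoneda D (star X) \<cdot> k\<rangle>"
          unfolding elts_yoneda[OF category_star] by blast
        obtain m where m: "\<langle>k, m\<rangle> \<in> elts (star (yoneda C X))"
          using defined[OF k(1)] by blast
        then show "z \<in> elts (star (yoneda C X))"
          using elements[OF m] k(2) by auto
      qed
    qed
  qed
qed

end

section \<open>Internal presheaves and representability\<close>

lemma hat_presheaves:
  assumes B: "base_set B" and "Mor C \<in> hat B" "N \<in> hat B"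
  shows "presheaves C N \<in> hat B" "is_set (presheaves C N)"
    "elts (presheaves C N) = {F. presheaf C N F}"
proof -
  let ?K = "power_set (cart (Mor C) (Mor (Ens N)))"
  have "presheaf C N F \<Longrightarrow> F \<in> elts ?K" for F
    unfolding presheaf_def is_functor_def using is_mapD(5)[of F "Mor C" "Mor (Ens N)"] by simp
  then have *: "{F. presheaf C N F} \<subseteq> elts ?K"
    by blast
  show set: "is_set (presheaves C N)" and elts: "elts (presheaves C N) = {F. presheaf C N F}"
    unfolding presheaves_def using * by (rule mk_set_subset)+
  have "?K \<in> hat B"
    using assms by (intro hat_power_set hat_cart hat_Ens)
  then show "presheaves C N \<in> hat B"
    using * hat_subset[OF B set] elts by blast
qed

text \<open>
  In addition, a set \<open>N\<close> in which presheaves take their values; \<open>E\<close> is its category of sets and \<open>E'\<close>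
  the enlarged category.
\<close>

locale nonstandard_presheaves = nonstandard_category S W star C
  for S W :: "'v::set_universe" and star :: "'v \<Rightarrow> 'v" and C :: "'v cat" +
  fixes N :: 'v
  assumes N: "N \<in> hat S - elts S"
begin

abbreviation "E \<equiv> Ens N"

abbreviation "E' \<equiv> star_cat star (Ens N)"

lemma hat_N: "N \<in> hat S"
  using N by blast

lemmas hat_E = hat_Ens[OF base_S hat_N]

lemmas Psh = hat_presheaves[OF base_S hat_Mor hat_N]

text \<open>\<open>E'\<close> is the subcategory of \<open>Ens (star N)\<close> with only some of the maps as morphisms.\<close>

lemma star_Ens_subcategory:
  shows "elts (Mor E') \<subseteq> elts (Mor (Ens (star N)))"
    and "m \<in> elts (Mor E') \<Longrightarrow> Src E' \<cdot> m = Src (Ens (star N)) \<cdot> m \<and> Tgt E' \<cdot> m = Tgt (Ens (star N)) \<cdot> m"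
    and "elts (Cmp E') \<subseteq> elts (Cmp (Ens (star N)))"
proof -
  let ?K = "power_set (cart (big_union N) (big_union N))"
  have K: "?K \<in> hat S"
    using hat_N by (intro hat_power_set hat_cart hat_big_union base_S)
  note hat = K hat_N hat_E
  have "(\<forall>m\<in>elts (Mor E). \<exists>A\<in>elts N. \<exists>B\<in>elts N. \<exists>f\<in>elts ?K. \<exists>i\<in>elts ?K. \<exists>j\<in>elts ?K.
      m = \<langle>A, B, f\<rangle> \<and> is_map f A B \<and> Src E \<cdot> m = \<langle>A, A, i\<rangle> \<and> Tgt E \<cdot> m = \<langle>B, B, j\<rangle> \<and>
      i = lam A (\<lambda>x. x) \<and> j = lam B (\<lambda>x. x)) \<longleftrightarrow>
    (\<forall>m\<in>elts (Mor E'). \<exists>A\<in>elts (star N). \<exists>B\<in>elts (star N).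
      \<exists>f\<in>elts (star ?K). \<exists>i\<in>elts (star ?K). \<exists>j\<in>elts (star ?K).
      m = \<langle>A, B, f\<rangle> \<and> is_map f A B \<and> Src E' \<cdot> m = \<langle>A, A, i\<rangle> \<and> Tgt E' \<cdot> m = \<langle>B, B, j\<rangle> \<and>
      i = lam A (\<lambda>x. x) \<and> j = lam B (\<lambda>x. x))"
    unfolding cat.map_sel
    by (rule transfer, (rule hat transfers | (simp; fail))+)
  moreover have "\<forall>m\<in>elts (Mor E). \<exists>A\<in>elts N. \<exists>B\<in>elts N. \<exists>f\<in>elts ?K. \<exists>i\<in>elts ?K. \<exists>j\<in>elts ?K.
      m = \<langle>A, B, f\<rangle> \<and> is_map f A B \<and> Src E \<cdot> m = \<langle>A, A, i\<rangle> \<and> Tgt E \<cdot> m = \<langle>B, B, j\<rangle> \<and>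
      i = lam A (\<lambda>x. x) \<and> j = lam B (\<lambda>x. x)"
  proof
    fix m assume "m \<in> elts (Mor E)"
    then obtain A B f where m: "m = \<langle>A, B, f\<rangle>" "ens_map N A B f"
      by auto
    then have AB: "A \<in> elts N" "B \<in> elts N" "is_map f A B"
      unfolding ens_map_def by auto
    have "f \<in> elts ?K" "lam A (\<lambda>x. x) \<in> elts ?K" "lam B (\<lambda>x. x) \<in> elts ?K"
      using m(2) ens_map_id[OF AB(1)] ens_map_id[OF AB(2)] by (blast intro: ens_map_graph)+
    moreover have "Src E \<cdot> m = \<langle>A, A, lam A (\<lambda>x. x)\<rangle>" "Tgt E \<cdot> m = \<langle>B, B, lam B (\<lambda>x. x)\<rangle>"
      unfolding m(1) Src_Ens(3)[OF m(2)] Tgt_Ens(3)[OF m(2)] by (rule id_map_lam)+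
    ultimately show "\<exists>A\<in>elts N. \<exists>B\<in>elts N. \<exists>f\<in>elts ?K. \<exists>i\<in>elts ?K. \<exists>j\<in>elts ?K.
      m = \<langle>A, B, f\<rangle> \<and> is_map f A B \<and> Src E \<cdot> m = \<langle>A, A, i\<rangle> \<and> Tgt E \<cdot> m = \<langle>B, B, j\<rangle> \<and>
      i = lam A (\<lambda>x. x) \<and> j = lam B (\<lambda>x. x)"
      using m(1) AB by blast
  qed
  ultimately have Mor: "\<exists>A B f. m = \<langle>A, B, f\<rangle> \<and> ens_map (star N) A B f \<and>
      Src E' \<cdot> m = id_map A \<and> Tgt E' \<cdot> m = id_map B" if "m \<in> elts (Mor E')" for m
    using that unfolding ens_map_def id_map_lam by blast
  then show "elts (Mor E') \<subseteq> elts (Mor (Ens (star N)))"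
    unfolding Mor_Ens(2) by blast
  show "Src E' \<cdot> m = Src (Ens (star N)) \<cdot> m \<and> Tgt E' \<cdot> m = Tgt (Ens (star N)) \<cdot> m"
    if m: "m \<in> elts (Mor E')"
  proof -
    obtain A B f where "m = \<langle>A, B, f\<rangle>" "ens_map (star N) A B f"
      "Src E' \<cdot> m = id_map A" "Tgt E' \<cdot> m = id_map B"
      using Mor[OF m] by blast
    then show ?thesis
      by (simp add: Src_Ens(3) Tgt_Ens(3))
  qed
  have "(\<forall>z\<in>elts (Cmp E). \<exists>A\<in>elts N. \<exists>B\<in>elts N. \<exists>D\<in>elts N. \<exists>f\<in>elts ?K. \<exists>g\<in>elts ?K. \<exists>h\<in>elts ?K.
      z = \<langle>\<langle>B, D, g\<rangle>, \<langle>A, B, f\<rangle>, \<langle>A, D, h\<rangle>\<rangle> \<and> is_map f A B \<and> is_map g B D \<and> is_map h A D \<and>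
      (\<forall>x\<in>elts A. h \<cdot> x = g \<cdot> (f \<cdot> x))) \<longleftrightarrow>
    (\<forall>z\<in>elts (Cmp E'). \<exists>A\<in>elts (star N). \<exists>B\<in>elts (star N). \<exists>D\<in>elts (star N).
      \<exists>f\<in>elts (star ?K). \<exists>g\<in>elts (star ?K). \<exists>h\<in>elts (star ?K).
      z = \<langle>\<langle>B, D, g\<rangle>, \<langle>A, B, f\<rangle>, \<langle>A, D, h\<rangle>\<rangle> \<and> is_map f A B \<and> is_map g B D \<and> is_map h A D \<and>
      (\<forall>x\<in>elts A. h \<cdot> x = g \<cdot> (f \<cdot> x)))"
    unfolding cat.map_sel
    by (rule transfer, (rule hat transfers | (simp; fail))+)
  moreover have "\<exists>A\<in>elts N. \<exists>B\<in>elts N. \<exists>D\<in>elts N. \<exists>f\<in>elts ?K. \<exists>g\<in>elts ?K. \<exists>h\<in>elts ?K.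
      z = \<langle>\<langle>B, D, g\<rangle>, \<langle>A, B, f\<rangle>, \<langle>A, D, h\<rangle>\<rangle> \<and> is_map f A B \<and> is_map g B D \<and> is_map h A D \<and>
      (\<forall>x\<in>elts A. h \<cdot> x = g \<cdot> (f \<cdot> x))" if z: "z \<in> elts (Cmp E)" for z
  proof -
    obtain A B D f g h where "z = \<langle>\<langle>B, D, g\<rangle>, \<langle>A, B, f\<rangle>, \<langle>A, D, h\<rangle>\<rangle>"
      and maps: "ens_map N A B f" "ens_map N B D g" "ens_map N A D h"
      and "\<forall>x\<in>elts A. h \<cdot> x = g \<cdot> (f \<cdot> x)"
      using z unfolding Cmp_Ens(2) by blast
    moreover have "f \<in> elts ?K" "g \<in> elts ?K" "h \<in> elts ?K"
      using maps by (blast intro: ens_map_graph)+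
    ultimately show ?thesis
      unfolding ens_map_def by blast
  qed
  ultimately have "\<forall>z\<in>elts (Cmp E'). \<exists>A\<in>elts (star N). \<exists>B\<in>elts (star N). \<exists>D\<in>elts (star N).
      \<exists>f\<in>elts (star ?K). \<exists>g\<in>elts (star ?K). \<exists>h\<in>elts (star ?K).
      z = \<langle>\<langle>B, D, g\<rangle>, \<langle>A, B, f\<rangle>, \<langle>A, D, h\<rangle>\<rangle> \<and> is_map f A B \<and> is_map g B D \<and> is_map h A D \<and>
      (\<forall>x\<in>elts A. h \<cdot> x = g \<cdot> (f \<cdot> x))"
    by blast
  then show "elts (Cmp E') \<subseteq> elts (Cmp (Ens (star N)))"
    unfolding Cmp_Ens(2) ens_map_def by blast
qed

text \<open>
  An internal \<open>F\<close> lies in \<open>star A\<close> for some \<open>A\<close>, and being a presheaf is a bounded condition on the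
  elements \<open>F\<close> of \<open>A\<close>.
\<close>

lemma internal_presheaf_iff:
  "internal_presheaf S star C N F \<longleftrightarrow> F \<in> elts (star (presheaves C N))"
proof -
  have *: "F \<in> elts (star (presheaves C N)) \<longleftrightarrow> is_functor (opcat D) E' F"
    if A: "A \<in> hat S" and F: "F \<in> elts (star A)" for A
  proof -
    note hat = A Psh(1) hat_C hat_E
    have "(\<forall>F\<in>elts A. F \<in> elts (presheaves C N) \<longleftrightarrow> is_functor (opcat C) E F) \<longleftrightarrow>
        (\<forall>F\<in>elts (star A). F \<in> elts (star (presheaves C N)) \<longleftrightarrow> is_functor (opcat D) E' F)"
      unfolding contravariant_functor_bounded[OF C] contravariant_functor_bounded[OF category_star]
        cat.map_sel
      by (rule transfer, (rule hat transfers | (simp; fail))+)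
    then show ?thesis
      using F Psh(3) presheaf_def by blast
  qed
  have "presheaves C N \<in> hat S - elts S"
    using Psh(1,2) is_set_hat_iff[OF base_S] by blast
  then show ?thesis
    unfolding internal_presheaf_def internal_def using * by blast
qed

lemma presheaf_if_internal:
  assumes "internal_presheaf S star C N F"
  shows "presheaf D (star N) F"
proof -
  have "is_functor (opcat D) E' F"
    using assms unfolding internal_presheaf_def by blast
  then show ?thesis
    unfolding presheaf_def using star_Ens_subcategory by (rule is_functor_subcategory)
qed

lemma internal_presheaf_star: "presheaf C N F \<Longrightarrow> internal_presheaf S star C N (star F)"
proof -
  assume "presheaf C N F"
  then have "F \<in> elts (presheaves C N)"
    using Psh(3) by blast
  moreover from this have "F \<in> hat S"
    using hat_transitive[OF base_S Psh(1)] by blast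
  ultimately show ?thesis
    unfolding internal_presheaf_iff using star_mem_iff[OF _ Psh(1)] by blast
qed

text \<open>Variables 0 and 1 stand for the presheaf and the object, as in \<open>assign\<close>.\<close>

lemma trf_sat:
  assumes "formula_in S \<psi>" "fv \<psi> \<subseteq> {0, 1}"
  shows "trf (Suc (Suc 0)) (\<lambda>e. sat (assign (e 0) (e (Suc 0))) \<psi>)
    (\<lambda>e. sat (assign (e 0) (e (Suc 0))) (map_fm star \<psi>))"
proof -
  have "sat (assign (e 0) (e (Suc 0))) q \<longleftrightarrow> sat e q" if "fv q \<subseteq> {0, 1}" for q and e :: "nat \<Rightarrow> 'v"
    by (rule sat_cong) (use that in \<open>auto simp: assign_def\<close>)
  then have "sat (assign (e 0) (e (Suc 0))) \<psi> \<longleftrightarrow> sat e \<psi>"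
    "sat (assign (e 0) (e (Suc 0))) (map_fm star \<psi>) \<longleftrightarrow> sat e (map_fm star \<psi>)" for e
    using assms(2) fv_map[of star \<psi>] by metis+
  then show ?thesis
    unfolding trf_def using assms by (intro exI[of _ \<psi>]) auto
qed

lemma trf_representation_within:
  assumes L: "L \<in> hat S"
  shows "trf (Suc (Suc 0)) (\<lambda>e. \<exists>\<tau>\<in>elts L. representation_within L C (e 0) (e (Suc 0)) \<tau>)
    (\<lambda>e. \<exists>\<tau>\<in>elts (star L). representation_within (star L) D (e 0) (e (Suc 0)) \<tau>)"
  unfolding representation_within_def cat.map_sel star_Ob
  by (rule L hat_C transfers | (simp; fail))+

text \<open>
  The levels of \<open>hat S\<close> that contain all presheaves and all their representations.
\<close>

definition large_level :: "nat \<Rightarrow> bool" where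
  "large_level n \<longleftrightarrow> elts (presheaves C N) \<subseteq> level S n \<and>
     (\<forall>F X \<tau>. presheaf C N F \<and> X \<in> elts (Ob C) \<and> representation C N F X \<tau> \<longrightarrow> \<tau> \<in> level S n)"

lemma large_level_mono: "large_level m \<Longrightarrow> m \<le> n \<Longrightarrow> large_level n"
  unfolding large_level_def using level_mono[of m n S] by blast

lemma ex_large_level: "\<exists>n. large_level n"
proof -
  let ?E = "Ens (set_union N (power_set (Mor C)))"
  let ?T = "power_set (cart (Ob C) (Mor ?E))"
  have "?T \<in> hat S"
    unfolding set_union_eq
    by (intro hat_power_set hat_cart hat_Ens hat_big_union hat_doubleton base_S hat_N hat_Ob hat_Mor)
  then obtain m where m: "elts ?T \<subseteq> level S m"
    by (rule hat_bounded[OF base_S])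
  obtain n where n: "elts (presheaves C N) \<subseteq> level S n"
    using Psh(1) by (rule hat_bounded[OF base_S])
  have "\<tau> \<in> elts ?T" if "presheaf C N F" "X \<in> elts (Ob C)" "representation C N F X \<tau>" for F X \<tau>
    using that(3) is_mapD(5)[of \<tau> "Ob C" "Mor ?E"] unfolding representation_iff[OF C that(1,2)] by blast
  then have "large_level (max m n)"
    unfolding large_level_def using m n level_mono[of m "max m n" S] level_mono[of n "max m n" S]
    by (meson max.cobounded1 max.cobounded2 subsetD order_trans)
  then show ?thesis
    by blast
qed

abbreviation "L n \<equiv> level_set S n"

lemma hat_L: "L n \<in> hat S"
  by (rule level_set_in_hat[OF base_S])

lemma star_L_transitive:
  assumes "x \<in> elts (star (L n))" "y \<in> elts x"
  shows "y \<in> elts (star (L n))"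
proof -
  have "(\<forall>x\<in>elts (L n). \<forall>y\<in>elts x. y \<in> elts (L n)) \<longleftrightarrow>
      (\<forall>x\<in>elts (star (L n)). \<forall>y\<in>elts x. y \<in> elts (star (L n)))"
    by (rule transfer, (rule hat_L transfers | (simp; fail))+)
  then show ?thesis
    using assms level_transitive[OF base_S] by auto
qed

lemma standard_representable_iff:
  assumes n: "large_level n" and F: "F \<in> elts (presheaves C N)" and X: "X \<in> elts (Ob C)"
  shows "representable_by C N F X \<longleftrightarrow> (\<exists>\<tau>\<in>elts (L n). representation_within (L n) C F X \<tau>)"
proof -
  have F': "presheaf C N F" and FL: "F \<in> elts (L n)"
    using n F Psh(3) unfolding large_level_def by auto
  have "representation C N F X \<tau> \<longleftrightarrow> representation_within (L n) C F X \<tau>" if "\<tau> \<in> elts (L n)" for \<tau>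
    using representation_iff_within[OF C F' X _ FL that] level_transitive[OF base_S] by simp
  moreover have "\<tau> \<in> elts (L n)" if "representation C N F X \<tau>" for \<tau>
    using n F' X that unfolding large_level_def by auto
  ultimately show ?thesis
    unfolding representable_by_def using X by blast
qed

text \<open>The formula is the condition \<open>representation_within\<close> for a large level.\<close>

lemma ex_says_representable: "\<exists>\<psi>. says_representable S C N \<psi>"
proof -
  obtain n where n: "large_level n"
    using ex_large_level by blast
  obtain \<psi> where \<psi>: "formula_in S \<psi>" "fv \<psi> \<subseteq> {..<Suc (Suc 0)}"
    "\<And>e. e \<in> envs S \<Longrightarrow> (\<exists>\<tau>\<in>elts (L n). representation_within (L n) C (e 0) (e (Suc 0)) \<tau>) \<longleftrightarrow> sat e \<psi>"
    using trf_representation_within[OF hat_L[of n]] unfolding trf_def by blast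
  have "sat (assign F X) \<psi> \<longleftrightarrow> representable_by C N F X"
    if F: "F \<in> elts (presheaves C N)" and X: "X \<in> elts (Ob C)" for F X
  proof -
    have "assign F X \<in> envs S"
      using hat_transitive[OF base_S Psh(1) F] hat_transitive[OF base_S hat_Ob X]
      by (auto simp: envs_def assign_def)
    then show ?thesis
      using \<psi>(3)[of "assign F X"] standard_representable_iff[OF n F X] by (simp add: assign_def)
  qed
  moreover have "fv \<psi> \<subseteq> {0, 1}"
    using \<psi>(2) by (auto simp: less_Suc_eq)
  ultimately show ?thesis
    unfolding says_representable_def using \<psi>(1) by blast
qed

text \<open>
  On \<open>presheaves C N\<close> and \<open>Ob C\<close> the formula \<open>\<psi>\<close> agrees with \<open>representation_within (L n)\<close> for every
  large level \<open>n\<close>.  After transfer, the representations may be taken from any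
  \<open>star (L n)\<close> with large \<open>n\<close>, and these sets exhaust the internal objects.
\<close>

lemma star_says_representable:
  assumes \<psi>: "says_representable S C N \<psi>"
    and F: "F \<in> elts (star (presheaves C N))" and X: "X \<in> elts (star (Ob C))"
  shows "sat (assign F X) (map_fm star \<psi>) \<longleftrightarrow> internally_representable_by S star C N F X"
proof -
  have F': "presheaf D (star N) F"
    using F internal_presheaf_iff presheaf_if_internal by blast
  have X': "X \<in> elts (Ob D)"
    using X star_Ob by simp
  have level: "sat (assign F X) (map_fm star \<psi>) \<longleftrightarrow> (\<exists>\<tau>\<in>elts (star (L n)). representation D (star N) F X \<tau>)"
    if n: "large_level n" for n
  proof -
    have "formula_in S \<psi>" "fv \<psi> \<subseteq> {0, 1}"
      using \<psi> unfolding says_representable_def by blast+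
    note trf_sat = trf_sat[OF this]
    have "(\<forall>F\<in>elts (presheaves C N). \<forall>X\<in>elts (Ob C). sat (assign F X) \<psi> \<longleftrightarrow>
          (\<exists>\<tau>\<in>elts (L n). representation_within (L n) C F X \<tau>)) \<longleftrightarrow>
        (\<forall>F\<in>elts (star (presheaves C N)). \<forall>X\<in>elts (star (Ob C)). sat (assign F X) (map_fm star \<psi>) \<longleftrightarrow>
          (\<exists>\<tau>\<in>elts (star (L n)). representation_within (star (L n)) D F X \<tau>))"
      by (rule transfer, rule trf_all, rule trf_trm_const, rule Psh(1), rule trf_all,
          rule trf_trm_const, rule hat_Ob, rule trf_iff, rule trf_sat,
          rule trf_representation_within, rule hat_L) simp_all
    moreover have "\<forall>F\<in>elts (presheaves C N). \<forall>X\<in>elts (Ob C). sat (assign F X) \<psi> \<longleftrightarrow>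
          (\<exists>\<tau>\<in>elts (L n). representation_within (L n) C F X \<tau>)"
      using \<psi> standard_representable_iff[OF n] unfolding says_representable_def by blast
    ultimately have "sat (assign F X) (map_fm star \<psi>) \<longleftrightarrow>
        (\<exists>\<tau>\<in>elts (star (L n)). representation_within (star (L n)) D F X \<tau>)"
      using F X by blast
    moreover have "representation D (star N) F X \<tau> \<longleftrightarrow> representation_within (star (L n)) D F X \<tau>"
      if "\<tau> \<in> elts (star (L n))" for \<tau>
    proof (rule representation_iff_within[OF category_star F' X'])
      show "F \<in> elts (star (L n))"
        using F n star_subset[OF Psh(1) hat_L] unfolding large_level_def by auto
    qed (use star_L_transitive that in blast)+
    ultimately show ?thesis
      by blast
  qed
  show ?thesis
  proof
    assume "sat (assign F X) (map_fm star \<psi>)"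
    moreover obtain n where n: "large_level n"
      using ex_large_level by blast
    ultimately obtain \<tau> where "\<tau> \<in> elts (star (L n))" "representation D (star N) F X \<tau>"
      using level by blast
    moreover have "L n \<in> hat S - elts S"
    proof -
      have "is_set (L n)"
        using base_S by (cases n) (auto simp: base_set_def)
      then show ?thesis
        using hat_L is_set_hat_iff[OF base_S] by blast
    qed
    ultimately show "internally_representable_by S star C N F X"
      unfolding internally_representable_by_def internal_def using X' by blast
  next
    assume "internally_representable_by S star C N F X"
    then obtain A \<tau> where A: "A \<in> hat S" "\<tau> \<in> elts (star A)" and \<tau>: "representation D (star N) F X \<tau>"
      unfolding internally_representable_by_def internal_def by blast
    obtain m where "elts A \<subseteq> level S m"
      using A(1) by (rule hat_bounded[OF base_S])
    moreover obtain k where "large_level k"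
      using ex_large_level by blast
    ultimately have "elts A \<subseteq> elts (L (max m k))" "large_level (max m k)"
      using level_mono[of m "max m k" S] large_level_mono[of k "max m k"] by auto
    moreover from this have "\<tau> \<in> elts (star (L (max m k)))"
      using A star_subset[OF A(1) hat_L] by blast
    ultimately show "sat (assign F X) (map_fm star \<psi>)"
      using level \<tau> by blast
  qed
qed

lemma star_representability_formula:
  assumes "says_representable S C N \<psi>"
  shows "sat (assign F X) (map_fm star (representability_formula C N \<psi>)) \<longleftrightarrow>
    internal_presheaf S star C N F \<and> internally_representable_by S star C N F X"
proof -
  have "sat (assign F X) (map_fm star (representability_formula C N \<psi>)) \<longleftrightarrow>
      F \<in> elts (star (presheaves C N)) \<and> X \<in> elts (star (Ob C)) \<and> sat (assign F X) (map_fm star \<psi>)"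
    unfolding representability_formula_def by (simp add: assign_def)
  also have "\<dots> \<longleftrightarrow> F \<in> elts (star (presheaves C N)) \<and> internally_representable_by S star C N F X"
    using star_says_representable[OF assms] star_Ob unfolding internally_representable_by_def by auto
  finally show ?thesis
    unfolding internal_presheaf_iff .
qed

lemma representable_by_if_internally:
  "internally_representable_by S star C N F X \<Longrightarrow> representable_by D (star N) F X"
  unfolding internally_representable_by_def representable_by_def by blast

lemma star_representable_by:
  assumes F: "presheaf C N F" and X: "X \<in> elts (Ob C)" and "representable_by C N F X"
  shows "representable_by D (star N) (star F) (star X)"
proof -
  obtain \<psi> where \<psi>: "says_representable S C N \<psi>"
    using ex_says_representable by blast
  have F': "F \<in> elts (presheaves C N)"
    using F Psh(3) by blast
  have hat: "F \<in> hat S" "X \<in> hat S"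
    using hat_transitive[OF base_S Psh(1) F'] hat_transitive[OF base_S hat_Ob X] by auto
  have "formula_in S \<psi>" "fv \<psi> \<subseteq> {0, 1}"
    using \<psi> unfolding says_representable_def by blast+
  note trf_sat = trf_sat[OF this]
  have stars: "star F \<in> elts (star (presheaves C N))" "star X \<in> elts (star (Ob C))"
    using star_mem_iff hat Psh(1) hat_Ob F' X by blast+
  \<comment> \<open>the constants \<open>F\<close> and \<open>X\<close> are named by equations, as \<open>\<psi>\<close> is only evaluated at variables\<close>
  have "(\<forall>G\<in>elts (presheaves C N). \<forall>Y\<in>elts (Ob C). G = F \<longrightarrow> Y = X \<longrightarrow> sat (assign G Y) \<psi>) \<longleftrightarrow>
      (\<forall>G\<in>elts (star (presheaves C N)). \<forall>Y\<in>elts (star (Ob C)).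
        G = star F \<longrightarrow> Y = star X \<longrightarrow> sat (assign G Y) (map_fm star \<psi>))"
    by (rule transfer, rule trf_all, rule trf_trm_const, rule Psh(1), rule trf_all,
        rule trf_trm_const, rule hat_Ob, (rule trf_imp trf_sat hat trf_eq trf_trms | (simp; fail))+)
  moreover have "sat (assign F X) \<psi>"
    using \<psi> F' X assms(3) unfolding says_representable_def by blast
  ultimately have "sat (assign (star F) (star X)) (map_fm star \<psi>)"
    using stars by blast
  with stars show ?thesis
    using star_says_representable[OF \<psi>] representable_by_if_internally by blast
qed

lemma star_all_representable:
  assumes all: "\<And>F. presheaf C N F \<Longrightarrow> representable C N F"
    and F: "internal_presheaf S star C N F"
  shows "representable D (star N) F"
proof -
  obtain \<psi> where \<psi>: "says_representable S C N \<psi>"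
    using ex_says_representable by blast
  then have "formula_in S \<psi>" "fv \<psi> \<subseteq> {0, 1}"
    unfolding says_representable_def by blast+
  note trf_sat = trf_sat[OF this]
  have "(\<forall>F\<in>elts (presheaves C N). \<exists>X\<in>elts (Ob C). sat (assign F X) \<psi>) \<longleftrightarrow>
      (\<forall>F\<in>elts (star (presheaves C N)). \<exists>X\<in>elts (star (Ob C)). sat (assign F X) (map_fm star \<psi>))"
    by (rule transfer, rule trf_all, rule trf_trm_const, rule Psh(1), rule trf_ex,
        rule trf_trm_const, rule hat_Ob, rule trf_sat) simp_all
  moreover have "\<forall>F\<in>elts (presheaves C N). \<exists>X\<in>elts (Ob C). sat (assign F X) \<psi>"
    using all \<psi> Psh(3) unfolding says_representable_def representable_def representable_by_def by blast
  ultimately obtain X where "X \<in> elts (star (Ob C))" "sat (assign F X) (map_fm star \<psi>)"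
    using F unfolding internal_presheaf_iff by blast
  then show ?thesis
    using star_says_representable[OF \<psi>] F representable_by_if_internally
    unfolding internal_presheaf_iff representable_def by blast
qed

end

theorem corollary2p16:
  fixes S W N :: "'v::set_universe" and star :: "'v \<Rightarrow> 'v" and C :: "'v cat"
  assumes "enlargement S W star"
    and "N \<in> hat S - elts S" and "\<forall>A\<in>elts N. is_set A"
    and "small_category S C"
    and "elts (Mor C) \<subseteq> elts N"
  shows
    "(\<forall>F. presheaf C N F \<longrightarrow> presheaf (star_cat star C) (star N) (star F)) \<and>
     (\<forall>X\<in>elts (Ob C).
        presheaf C (power_set (Mor C)) (yoneda C X) \<and>
        star (yoneda C X) = yoneda (star_cat star C) (star X)) \<and>
     ((\<exists>\<psi>. says_representable S C N \<psi>) \<and>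
      (\<forall>\<psi>. says_representable S C N \<psi> \<longrightarrow>
        (\<forall>F\<in>hat W. \<forall>X\<in>hat W.
           sat (assign F X) (map_fm star (representability_formula C N \<psi>)) \<longleftrightarrow>
           internal_presheaf S star C N F \<and> internally_representable_by S star C N F X))) \<and>
     (\<forall>F X. presheaf C N F \<and> X \<in> elts (Ob C) \<and> representable_by C N F X \<longrightarrow>
        representable_by (star_cat star C) (star N) (star F) (star X)) \<and>
     ((\<forall>F. presheaf C N F \<longrightarrow> representable C N F) \<longrightarrow>
        (\<forall>F. internal_presheaf S star C N F \<longrightarrow>
           representable (star_cat star C) (star N) F))"
proof -
  interpret nonstandard_presheaves S W star C N
    using assms(1,2,4) by unfold_locales
  show ?thesis
    using internal_presheaf_star presheaf_if_internal presheaf_yoneda[OF C] star_yoneda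
      ex_says_representable star_representability_formula star_representable_by star_all_representable
    by blast
qed

end
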